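(* Let $\Bbbk$ be a field, $n\ge 1$, $S=\{1,\dots,n\}$, and let $B=\Bbbk^{\oplus n}=\Bbbk e_1\oplus\cdots\oplus\Bbbk e_n$ be the commutative algebra with primitive orthogonal idempotents $e_1,\dots,e_n$ (so $e_ie_j=\delta_{ij}e_i$ and $1_B=e_1+\cdots+e_n$). Monoid structures on $S$ and bialgebra structures on $B$ (with this fixed algebra structure) correspond to each other in the following sense. (a) If $(\Delta,\varepsilon)$ makes $B$ a bialgebra, and $\Delta(e_k)=\sum_{i,j=1}^n a_{ij}^k\, e_i\otimes e_j$ with $a_{ij}^k\in\Bbbk$, then for every $(i,j)\in S\times S$ there is a unique $k\in S$ with $a_{ij}^k=1$, and the binary operation on $S$ defined by $i\cdot j=k$ if $a_{ij}^k=1$ makes $S$ a monoid. (b) Conversely, if $(S,\cdot)$ is a monoid with identity element $u\in S$, then the linear maps $\Delta:B\to B\otimes B$ and $\varepsilon:B\to\Bbbk$ given by $$\Delta(e_i)=\sum_{\substack{(k,l)\in S\times S\\ k\cdot l=i}} e_k\otimes e_l,\qquad \varepsilon(e_i)=\delta_{ui}$$ make $B$ a bialgebra.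
   Context: A bialgebra over $\Bbbk$ is an associative unital algebra $B$ that is also a coassociative counital coalgebra $(B,\Delta,\varepsilon)$ such that $\Delta:B\to B\otimes B$ and $\varepsilon:B\to\Bbbk$ are unital algebra morphisms. Tensor products are over $\Bbbk$. *)

theory Defs
  imports "HOL-Algebra.Module" "HOL-Algebra.AbelCoset"
begin

section \<open>Linear maps and algebras over a field\<close>

definition linear_maps ::
    "('k, 'm) ring_scheme \<Rightarrow> ('k, 'a, 'n) module_scheme \<Rightarrow> ('k, 'b, 'o) module_scheme \<Rightarrow> ('a \<Rightarrow> 'b) set"
  where "linear_maps K V W =
    {f. f \<in> carrier V \<rightarrow> carrier W \<and>
        (\<forall>x\<in>carrier V. \<forall>y\<in>carrier V. f (x \<oplus>\<^bsub>V\<^esub> y) = f x \<oplus>\<^bsub>W\<^esub> f y) \<and>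
        (\<forall>c\<in>carrier K. \<forall>x\<in>carrier V. f (c \<odot>\<^bsub>V\<^esub> x) = c \<odot>\<^bsub>W\<^esub> f x)}"

definition bilinear_maps ::
    "('k, 'm) ring_scheme \<Rightarrow> ('k, 'a, 'n) module_scheme \<Rightarrow> ('k, 'b, 'o) module_scheme \<Rightarrow>
     ('k, 'c, 'p) module_scheme \<Rightarrow> ('a \<Rightarrow> 'b \<Rightarrow> 'c) set"
  where "bilinear_maps K V W U =
    {\<beta>. (\<forall>x\<in>carrier V. \<beta> x \<in> linear_maps K W U) \<and>
        (\<forall>y\<in>carrier W. (\<lambda>x. \<beta> x y) \<in> linear_maps K V U)}"

text \<open>The locale \<^locale>\<open>algebra\<close> of the library is restricted to commutative algebras.\<close>

locale assoc_algebra = module K A + ring A for K (structure) and A (structure) +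
  assumes smult_mult_left:
      "\<lbrakk>c \<in> carrier K; x \<in> carrier A; y \<in> carrier A\<rbrakk>
        \<Longrightarrow> (c \<odot>\<^bsub>A\<^esub> x) \<otimes>\<^bsub>A\<^esub> y = c \<odot>\<^bsub>A\<^esub> (x \<otimes>\<^bsub>A\<^esub> y)"
    and smult_mult_right:
      "\<lbrakk>c \<in> carrier K; x \<in> carrier A; y \<in> carrier A\<rbrakk>
        \<Longrightarrow> x \<otimes>\<^bsub>A\<^esub> (c \<odot>\<^bsub>A\<^esub> y) = c \<odot>\<^bsub>A\<^esub> (x \<otimes>\<^bsub>A\<^esub> y)"

definition algebra_homs ::
    "('k, 'm) ring_scheme \<Rightarrow> ('k, 'a, 'n) module_scheme \<Rightarrow> ('k, 'b, 'o) module_scheme \<Rightarrow> ('a \<Rightarrow> 'b) set"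
  where "algebra_homs K A B = ring_hom A B \<inter> linear_maps K A B"

definition regular_algebra :: "('k, 'm) ring_scheme \<Rightarrow> ('k, 'k) module"
  where "regular_algebra K =
    \<lparr>carrier = carrier K, monoid.mult = monoid.mult K, one = \<one>\<^bsub>K\<^esub>, zero = \<zero>\<^bsub>K\<^esub>, add = add K, smult = monoid.mult K\<rparr>"


section \<open>Tensor products\<close>

text \<open>
  The tensor product of V and W is the free module on the set of pairs, i.e. the finitely
  supported functions on \<open>carrier V \<times> carrier W\<close>, modulo the submodule generated by the
  bilinearity relations. Its elements are cosets. In the records below that only carry a module
  structure, the ring fields \<open>mult\<close> and \<open>one\<close> are left undefined.
\<close>

definition free_module :: "('k, 'm) ring_scheme \<Rightarrow> 'x set \<Rightarrow> ('k, 'x \<Rightarrow> 'k) module"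
  where "free_module K X =
    \<lparr>carrier = {f. range f \<subseteq> carrier K \<and> {p. f p \<noteq> \<zero>\<^bsub>K\<^esub>} \<subseteq> X \<and> finite {p. f p \<noteq> \<zero>\<^bsub>K\<^esub>}},
     monoid.mult = undefined, one = undefined,
     zero = (\<lambda>p. \<zero>\<^bsub>K\<^esub>),
     add = (\<lambda>f g p. f p \<oplus>\<^bsub>K\<^esub> g p),
     smult = (\<lambda>c f p. c \<otimes>\<^bsub>K\<^esub> f p)\<rparr>"

definition free_gen :: "('k, 'm) ring_scheme \<Rightarrow> 'x \<Rightarrow> ('x \<Rightarrow> 'k)"
  where "free_gen K p = (\<lambda>q. if q = p then \<one>\<^bsub>K\<^esub> else \<zero>\<^bsub>K\<^esub>)"

abbreviation tensor_free ::
    "('k, 'm) ring_scheme \<Rightarrow> ('k, 'a, 'n) module_scheme \<Rightarrow> ('k, 'b, 'o) module_scheme \<Rightarrow>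
     ('k, 'a \<times> 'b \<Rightarrow> 'k) module"
  where "tensor_free K V W \<equiv> free_module K (carrier V \<times> carrier W)"

definition tensor_relators ::
    "('k, 'm) ring_scheme \<Rightarrow> ('k, 'a, 'n) module_scheme \<Rightarrow> ('k, 'b, 'o) module_scheme \<Rightarrow>
     ('a \<times> 'b \<Rightarrow> 'k) set"
  where "tensor_relators K V W =
    (let F = tensor_free K V W; \<delta> = free_gen K in
      {\<delta> (x \<oplus>\<^bsub>V\<^esub> x', y) \<ominus>\<^bsub>F\<^esub> (\<delta> (x, y) \<oplus>\<^bsub>F\<^esub> \<delta> (x', y)) | x x' y.
          x \<in> carrier V \<and> x' \<in> carrier V \<and> y \<in> carrier W} \<union>
      {\<delta> (x, y \<oplus>\<^bsub>W\<^esub> y') \<ominus>\<^bsub>F\<^esub> (\<delta> (x, y) \<oplus>\<^bsub>F\<^esub> \<delta> (x, y')) | x y y'.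
          x \<in> carrier V \<and> y \<in> carrier W \<and> y' \<in> carrier W} \<union>
      {\<delta> (c \<odot>\<^bsub>V\<^esub> x, y) \<ominus>\<^bsub>F\<^esub> (c \<odot>\<^bsub>F\<^esub> \<delta> (x, y)) | c x y.
          c \<in> carrier K \<and> x \<in> carrier V \<and> y \<in> carrier W} \<union>
      {\<delta> (x, c \<odot>\<^bsub>W\<^esub> y) \<ominus>\<^bsub>F\<^esub> (c \<odot>\<^bsub>F\<^esub> \<delta> (x, y)) | c x y.
          c \<in> carrier K \<and> x \<in> carrier V \<and> y \<in> carrier W})"

definition tensor_null ::
    "('k, 'm) ring_scheme \<Rightarrow> ('k, 'a, 'n) module_scheme \<Rightarrow> ('k, 'b, 'o) module_scheme \<Rightarrow>
     ('a \<times> 'b \<Rightarrow> 'k) set"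
  where "tensor_null K V W =
    \<Inter>{H. submodule H K (tensor_free K V W) \<and> tensor_relators K V W \<subseteq> H}"

definition pure_tensor ::
    "('k, 'm) ring_scheme \<Rightarrow> ('k, 'a, 'n) module_scheme \<Rightarrow> ('k, 'b, 'o) module_scheme \<Rightarrow>
     'a \<Rightarrow> 'b \<Rightarrow> ('a \<times> 'b \<Rightarrow> 'k) set"
  where "pure_tensor K V W x y = tensor_null K V W +>\<^bsub>tensor_free K V W\<^esub> free_gen K (x, y)"

definition tensor_module ::
    "('k, 'm) ring_scheme \<Rightarrow> ('k, 'a, 'n) module_scheme \<Rightarrow> ('k, 'b, 'o) module_scheme \<Rightarrow>
     ('k, ('a \<times> 'b \<Rightarrow> 'k) set) module"
  where "tensor_module K V W = (let F = tensor_free K V W; N = tensor_null K V W in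
    \<lparr>carrier = a_rcosets\<^bsub>F\<^esub> N,
     monoid.mult = undefined, one = undefined,
     zero = N,
     add = set_add F,
     smult = (\<lambda>c X. \<Union>f\<in>X. N +>\<^bsub>F\<^esub> (c \<odot>\<^bsub>F\<^esub> f))\<rparr>)"

text \<open>
  \<open>tensor_lift K U \<beta>\<close> is the linear map \<open>V \<otimes> W \<rightarrow> U\<close> that sends \<open>x \<otimes> y\<close> to \<open>\<beta> x y\<close>,
  for bilinear \<open>\<beta> : V \<times> W \<rightarrow> U\<close>: it sends the coset of a formal sum f to
  \<open>\<Sum>\<^sub>(\<^sub>x\<^sub>,\<^sub>y\<^sub>) f (x, y) \<odot> \<beta> x y\<close>, which does not depend on f.
\<close>

definition tensor_lift ::
    "('k, 'm) ring_scheme \<Rightarrow> ('k, 'c, 'p) module_scheme \<Rightarrow> ('a \<Rightarrow> 'b \<Rightarrow> 'c) \<Rightarrow>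
     ('a \<times> 'b \<Rightarrow> 'k) set \<Rightarrow> 'c"
  where "tensor_lift K U \<beta> X =
    (THE u. \<forall>f\<in>X. u = finsum U (\<lambda>(x, y). f (x, y) \<odot>\<^bsub>U\<^esub> \<beta> x y) {p. f p \<noteq> \<zero>\<^bsub>K\<^esub>})"

text \<open>
  For algebras A and B the multiplication on \<open>A \<otimes> B\<close> is the bilinear extension of
  \<open>(a \<otimes> b) (c \<otimes> d) = (a c) \<otimes> (b d)\<close>.
\<close>

definition tensor_algebra ::
    "('k, 'm) ring_scheme \<Rightarrow> ('k, 'a, 'n) module_scheme \<Rightarrow> ('k, 'b, 'o) module_scheme \<Rightarrow>
     ('k, ('a \<times> 'b \<Rightarrow> 'k) set) module"
  where "tensor_algebra K A B = (let T = tensor_module K A B in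
    T \<lparr>monoid.mult := (\<lambda>X Y. tensor_lift K T (\<lambda>a b.
                 tensor_lift K T (\<lambda>c d. pure_tensor K A B (a \<otimes>\<^bsub>A\<^esub> c) (b \<otimes>\<^bsub>B\<^esub> d)) Y) X),
       one := pure_tensor K A B \<one>\<^bsub>A\<^esub> \<one>\<^bsub>B\<^esub>\<rparr>)"

definition tensor_map ::
    "('k, 'm) ring_scheme \<Rightarrow> ('k, 'c, 'n) module_scheme \<Rightarrow> ('k, 'd, 'o) module_scheme \<Rightarrow>
     ('a \<Rightarrow> 'c) \<Rightarrow> ('b \<Rightarrow> 'd) \<Rightarrow> ('a \<times> 'b \<Rightarrow> 'k) set \<Rightarrow> ('c \<times> 'd \<Rightarrow> 'k) set"
  where "tensor_map K V' W' f g =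
    tensor_lift K (tensor_module K V' W') (\<lambda>x y. pure_tensor K V' W' (f x) (g y))"

definition tensor_assoc ::
    "('k, 'm) ring_scheme \<Rightarrow> ('k, 'a, 'n) module_scheme \<Rightarrow> ('k, 'b, 'o) module_scheme \<Rightarrow>
     ('k, 'c, 'p) module_scheme \<Rightarrow>
     (('a \<times> 'b \<Rightarrow> 'k) set \<times> 'c \<Rightarrow> 'k) set \<Rightarrow> ('a \<times> ('b \<times> 'c \<Rightarrow> 'k) set \<Rightarrow> 'k) set"
  where "tensor_assoc K U V W =
    (let VW = tensor_module K V W; T = tensor_module K U VW in
      tensor_lift K T (\<lambda>X z. tensor_lift K T (\<lambda>x y.
        pure_tensor K U VW x (pure_tensor K V W y z)) X))"


section \<open>The universal property of the tensor product\<close>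

text \<open>
  The pure tensor map is bilinear, and every bilinear map factors linearly through it via
  \<^const>\<open>tensor_lift\<close>.
\<close>

lemma free_module_module:
  assumes "cring K" shows "module K (free_module K X)"
proof -
  interpret K: cring K by fact
  let ?F = "free_module K X"
  have fin: "finite {p. (f p \<oplus>\<^bsub>K\<^esub> g p) \<noteq> \<zero>\<^bsub>K\<^esub>}" "{p. (f p \<oplus>\<^bsub>K\<^esub> g p) \<noteq> \<zero>\<^bsub>K\<^esub>} \<subseteq> X"
    if "f \<in> carrier ?F" "g \<in> carrier ?F" for f g
  proof -
    have "{p. (f p \<oplus>\<^bsub>K\<^esub> g p) \<noteq> \<zero>\<^bsub>K\<^esub>} \<subseteq> {p. f p \<noteq> \<zero>\<^bsub>K\<^esub>} \<union> {p. g p \<noteq> \<zero>\<^bsub>K\<^esub>}"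
      by auto
    with that show "finite {p. (f p \<oplus>\<^bsub>K\<^esub> g p) \<noteq> \<zero>\<^bsub>K\<^esub>}" "{p. (f p \<oplus>\<^bsub>K\<^esub> g p) \<noteq> \<zero>\<^bsub>K\<^esub>} \<subseteq> X"
      by (auto simp: free_module_def intro: finite_subset)
  qed
  have fins: "finite {p. (c \<otimes>\<^bsub>K\<^esub> g p) \<noteq> \<zero>\<^bsub>K\<^esub>}" "{p. (c \<otimes>\<^bsub>K\<^esub> g p) \<noteq> \<zero>\<^bsub>K\<^esub>} \<subseteq> X"
    if "c \<in> carrier K" "g \<in> carrier ?F" for c g
  proof -
    have "{p. (c \<otimes>\<^bsub>K\<^esub> g p) \<noteq> \<zero>\<^bsub>K\<^esub>} \<subseteq> {p. g p \<noteq> \<zero>\<^bsub>K\<^esub>}"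
      using that by auto
    with that show "finite {p. (c \<otimes>\<^bsub>K\<^esub> g p) \<noteq> \<zero>\<^bsub>K\<^esub>}" "{p. (c \<otimes>\<^bsub>K\<^esub> g p) \<noteq> \<zero>\<^bsub>K\<^esub>} \<subseteq> X"
      by (auto simp: free_module_def intro: finite_subset)
  qed
  have mem: "f p \<in> carrier K" if "f \<in> carrier ?F" for f p
    using that by (auto simp: free_module_def)
  show ?thesis
  proof (rule moduleI)
    show "abelian_group ?F"
    proof (rule abelian_groupI)
      fix f g assume "f \<in> carrier ?F" "g \<in> carrier ?F"
      then show "f \<oplus>\<^bsub>?F\<^esub> g \<in> carrier ?F"
        using fin[of f g] mem by (auto simp: free_module_def)
    next
      fix f assume f: "f \<in> carrier ?F"
      have e: "{p. \<ominus>\<^bsub>K\<^esub> f p \<noteq> \<zero>\<^bsub>K\<^esub>} = {p. f p \<noteq> \<zero>\<^bsub>K\<^esub>}"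
        using mem[OF f] by (metis K.add.inv_eq_1_iff)
      show "\<exists>g\<in>carrier ?F. g \<oplus>\<^bsub>?F\<^esub> f = \<zero>\<^bsub>?F\<^esub>"
        apply (rule bexI[of _ "\<lambda>p. \<ominus>\<^bsub>K\<^esub> f p"])
        using f mem[OF f] e by (auto simp: free_module_def K.l_neg)
    qed (auto simp: free_module_def image_subset_iff K.a_ac)
  next
    fix c f assume "c \<in> carrier K" "f \<in> carrier ?F"
    then show "c \<odot>\<^bsub>?F\<^esub> f \<in> carrier ?F"
      using fins[of c f] mem by (auto simp: free_module_def)
  qed (use assms in \<open>auto simp: free_module_def image_subset_iff K.l_distr K.r_distr K.m_assoc\<close>)
qed

locale tensor_of_modules = V: module K V + W: module K W for K (structure) and V (structure) and W (structure)
begin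

abbreviation "F \<equiv> tensor_free K V W"
abbreviation "N \<equiv> tensor_null K V W"

lemma K_cring: "cring K" by unfold_locales

sublocale F: module K F by (rule free_module_module[OF K_cring])

lemma free_gen_mem: "x \<in> carrier V \<Longrightarrow> y \<in> carrier W \<Longrightarrow> free_gen K (x,y) \<in> carrier F"
  by (auto simp: free_module_def free_gen_def)

lemma relators_sub: "tensor_relators K V W \<subseteq> carrier F"
  unfolding tensor_relators_def Let_def by (auto intro!: F.M.minus_closed F.M.add.m_closed free_gen_mem F.smult_closed)

lemma N_submodule: "submodule N K F"
proof -
  have c: "submodule (carrier F) K F" by (rule F.carrier_is_submodule)
  show ?thesis
    apply (rule F.submoduleI)
    unfolding tensor_null_def
    subgoal using c relators_sub by blast
    subgoal by (auto dest!: submodule.axioms(1) dest: subgroup.one_closed)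
    subgoal by (auto dest: F.submoduleE(3))
    subgoal by (auto dest: F.submoduleE(5))
    subgoal by (auto dest: F.submoduleE(4))
    done
qed

lemma relN: "tensor_relators K V W \<subseteq> N" unfolding tensor_null_def by blast

sublocale abelian_subgroup N F
  apply (rule abelian_subgroupI3)
  using N_submodule F.abelian_group_axioms by (auto simp: additive_subgroup_def submodule_def)

abbreviation "T \<equiv> tensor_module K V W"
abbreviation "q f \<equiv> N +>\<^bsub>F\<^esub> f"

lemma carT: "carrier T = q ` carrier F"
  by (auto simp: tensor_module_def Let_def A_RCOSETS_def RCOSETS_def a_r_coset_def)


lemma q_eq: assumes "f \<in> carrier F" "g \<in> carrier F" shows "q f = q g \<longleftrightarrow> f \<ominus>\<^bsub>F\<^esub> g \<in> N"
proof
  assume "q f = q g"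
  then have "f \<in> q g" using a_rcos_self[OF assms(1)] by simp
  then show "f \<ominus>\<^bsub>F\<^esub> g \<in> N"
    using a_rcos_module[OF assms(2,1)] by (simp add: a_minus_def)
next
  assume "f \<ominus>\<^bsub>F\<^esub> g \<in> N"
  then have "f \<in> q g"
    using a_rcos_module[OF assms(2,1)] by (simp add: a_minus_def)
  then show "q f = q g"
    using a_repr_independence' assms by metis
qed

lemma q_add: "f \<in> carrier F \<Longrightarrow> g \<in> carrier F \<Longrightarrow> q f \<oplus>\<^bsub>T\<^esub> q g = q (f \<oplus>\<^bsub>F\<^esub> g)"
  using a_rcos_sum by (simp add: tensor_module_def Let_def)

lemma q_mem: "f \<in> carrier F \<Longrightarrow> g \<in> q f \<Longrightarrow> g \<in> carrier F \<and> q g = q f"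
  using a_repr_independence' a_elemrcos_carrier by metis

lemma q_smult: assumes c: "c \<in> carrier K" and f: "f \<in> carrier F"
  shows "c \<odot>\<^bsub>T\<^esub> q f = q (c \<odot>\<^bsub>F\<^esub> f)"
proof -
  have "q (c \<odot>\<^bsub>F\<^esub> g) = q (c \<odot>\<^bsub>F\<^esub> f)" if "g \<in> q f" for g
  proof -
    have g: "g \<in> carrier F" "q g = q f" using q_mem[OF f that] by auto
    then have "g \<ominus>\<^bsub>F\<^esub> f \<in> N" using q_eq f by auto
    then have "c \<odot>\<^bsub>F\<^esub> (g \<ominus>\<^bsub>F\<^esub> f) \<in> N" using N_submodule c by (auto intro: submodule.smult_closed)
    moreover have "c \<odot>\<^bsub>F\<^esub> (g \<ominus>\<^bsub>F\<^esub> f) = c \<odot>\<^bsub>F\<^esub> g \<ominus>\<^bsub>F\<^esub> c \<odot>\<^bsub>F\<^esub> f"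
      using g f c by (simp add: a_minus_def F.smult_r_distr F.smult_r_minus)
    ultimately show ?thesis using q_eq g f c by auto
  qed
  moreover have "f \<in> q f" using a_rcos_self f by auto
  ultimately have "(\<Union>g\<in>q f. q (c \<odot>\<^bsub>F\<^esub> g)) = q (c \<odot>\<^bsub>F\<^esub> f)" by blast
  then show ?thesis by (simp add: tensor_module_def Let_def)
qed

lemma tensor_module_module: "module K T"
proof (rule moduleI)
  show "cring K" by (rule K_cring)
  have z: "\<zero>\<^bsub>T\<^esub> = q \<zero>\<^bsub>F\<^esub>"
    by (simp add: tensor_module_def Let_def a_subset)
  show "abelian_group T"
  proof (rule abelian_groupI)
    fix x assume "x \<in> carrier T"
    then obtain f where f: "f \<in> carrier F" "x = q f" by (auto simp: carT)
    then show "\<exists>y\<in>carrier T. y \<oplus>\<^bsub>T\<^esub> x = \<zero>\<^bsub>T\<^esub>"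
      by (intro bexI[of _ "q (\<ominus>\<^bsub>F\<^esub> f)"]) (auto simp: carT q_add z F.M.l_neg)
  qed (auto simp: carT q_add z F.M.a_ac)
qed (auto simp: carT q_add q_smult F.smult_l_distr F.smult_r_distr F.smult_assoc1)

sublocale T: module K T by (rule tensor_module_module)

lemma pure_bilinear: "pure_tensor K V W \<in> bilinear_maps K V W T"
proof -
  let ?d = "free_gen K"
  have p: "pure_tensor K V W x y = q (?d (x,y))" for x y by (simp add: pure_tensor_def)
  have R: "q a = q b" if "a \<ominus>\<^bsub>F\<^esub> b \<in> tensor_relators K V W" "a \<in> carrier F" "b \<in> carrier F" for a b
    using that relN q_eq by blast
  note m = free_gen_mem
  show ?thesis
    unfolding bilinear_maps_def linear_maps_def p mem_Collect_eq
  proof (intro conjI ballI)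
    fix x y y' assume a: "x \<in> carrier V" "y \<in> carrier W" "y' \<in> carrier W"
    show "q (?d (x, y \<oplus>\<^bsub>W\<^esub> y')) = q (?d (x, y)) \<oplus>\<^bsub>T\<^esub> q (?d (x, y'))"
      unfolding q_add[OF m m, OF a(1,2) a(1,3)]
      by (rule R) (unfold tensor_relators_def Let_def, use a in blast, auto simp: m a)
  next
    fix x y y' assume a: "y \<in> carrier W" "x \<in> carrier V" "y' \<in> carrier V"
    show "q (?d (x \<oplus>\<^bsub>V\<^esub> y', y)) = q (?d (x, y)) \<oplus>\<^bsub>T\<^esub> q (?d (y', y))"
      unfolding q_add[OF m m, OF a(2,1) a(3,1)]
      by (rule R) (unfold tensor_relators_def Let_def, use a in blast, auto simp: m a)
  next
    fix x c y assume a: "x \<in> carrier V" "c \<in> carrier K" "y \<in> carrier W"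
    show "q (?d (x, c \<odot>\<^bsub>W\<^esub> y)) = c \<odot>\<^bsub>T\<^esub> q (?d (x, y))"
      unfolding q_smult[OF a(2) m, OF a(1,3)]
      by (rule R) (unfold tensor_relators_def Let_def, use a in blast, auto simp: m a)
  next
    fix x c y assume a: "y \<in> carrier W" "c \<in> carrier K" "x \<in> carrier V"
    show "q (?d (c \<odot>\<^bsub>V\<^esub> x, y)) = c \<odot>\<^bsub>T\<^esub> q (?d (x, y))"
      unfolding q_smult[OF a(2) m, OF a(3,1)]
      by (rule R) (unfold tensor_relators_def Let_def, use a in blast, auto simp: m a)
  qed (auto simp: carT m)
qed

end

locale bilinear_on_tensor = tensor_of_modules K V W + U: module K U
  for K (structure) and V (structure) and W (structure) and U (structure) and \<beta> +
  assumes bil: "\<beta> \<in> bilinear_maps K V W U"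
begin

definition "ext f = finsum U (\<lambda>(x, y). f (x, y) \<odot>\<^bsub>U\<^esub> \<beta> x y) {p. f p \<noteq> \<zero>\<^bsub>K\<^esub>}"

lemma bmem: "x \<in> carrier V \<Longrightarrow> y \<in> carrier W \<Longrightarrow> \<beta> x y \<in> carrier U"
  using bil by (auto simp: bilinear_maps_def linear_maps_def)

lemma Fmem: "f \<in> carrier F \<Longrightarrow> f p \<in> carrier K" by (auto simp: free_module_def)

lemma ext_sup: assumes "f \<in> carrier F" "finite A" "{p. f p \<noteq> \<zero>} \<subseteq> A" "A \<subseteq> carrier V \<times> carrier W"
  shows "ext f = finsum U (\<lambda>(x, y). f (x, y) \<odot>\<^bsub>U\<^esub> \<beta> x y) A"
  unfolding ext_def
  apply (rule U.M.add.finprod_mono_neutral_cong_left)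
  using assms by (auto simp: Fmem bmem)

lemma supp: "f \<in> carrier F \<Longrightarrow> finite {p. f p \<noteq> \<zero>} \<and> {p. f p \<noteq> \<zero>} \<subseteq> carrier V \<times> carrier W"
  by (auto simp: free_module_def)

lemma ext_closed: "f \<in> carrier F \<Longrightarrow> ext f \<in> carrier U"
  unfolding ext_def apply (rule U.M.finsum_closed) using supp[of f] by (auto simp: Fmem bmem)

lemma ext_add: assumes "f \<in> carrier F" "g \<in> carrier F"
  shows "ext (f \<oplus>\<^bsub>F\<^esub> g) = ext f \<oplus>\<^bsub>U\<^esub> ext g"
proof -
  let ?A = "{p. f p \<noteq> \<zero>} \<union> {p. g p \<noteq> \<zero>}"
  have a: "finite ?A" "?A \<subseteq> carrier V \<times> carrier W" using supp assms by auto
  have v: "(f \<oplus>\<^bsub>F\<^esub> g) p = f p \<oplus> g p" for p by (simp add: free_module_def)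
  have "ext (f \<oplus>\<^bsub>F\<^esub> g) = finsum U (\<lambda>(x, y). (f \<oplus>\<^bsub>F\<^esub> g) (x, y) \<odot>\<^bsub>U\<^esub> \<beta> x y) ?A"
    by (rule ext_sup) (use assms a v in auto)
  also have "\<dots> = finsum U (\<lambda>p. (case p of (x, y) \<Rightarrow> f (x, y) \<odot>\<^bsub>U\<^esub> \<beta> x y) \<oplus>\<^bsub>U\<^esub> (case p of (x, y) \<Rightarrow> g (x, y) \<odot>\<^bsub>U\<^esub> \<beta> x y)) ?A"
    apply (rule U.M.finsum_cong')
    using a assms by (auto simp: v Fmem bmem U.smult_l_distr)
  also have "\<dots> = finsum U (\<lambda>(x, y). f (x, y) \<odot>\<^bsub>U\<^esub> \<beta> x y) ?A \<oplus>\<^bsub>U\<^esub> finsum U (\<lambda>(x, y). g (x, y) \<odot>\<^bsub>U\<^esub> \<beta> x y) ?A"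
    apply (rule U.M.finsum_addf) using a assms by (auto simp: Fmem bmem)
  also have "\<dots> = ext f \<oplus>\<^bsub>U\<^esub> ext g"
    using ext_sup[of f ?A] ext_sup[of g ?A] assms a by auto
  finally show ?thesis .
qed

lemma ext_smult: assumes "f \<in> carrier F" "c \<in> carrier K"
  shows "ext (c \<odot>\<^bsub>F\<^esub> f) = c \<odot>\<^bsub>U\<^esub> ext f"
proof -
  let ?A = "{p. f p \<noteq> \<zero>}"
  have a: "finite ?A" "?A \<subseteq> carrier V \<times> carrier W" using supp assms by auto
  have v: "(c \<odot>\<^bsub>F\<^esub> f) p = c \<otimes> f p" for p by (simp add: free_module_def)
  have "ext (c \<odot>\<^bsub>F\<^esub> f) = finsum U (\<lambda>(x, y). (c \<odot>\<^bsub>F\<^esub> f) (x, y) \<odot>\<^bsub>U\<^esub> \<beta> x y) ?A"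
    by (rule ext_sup) (use assms a v in auto)
  also have "\<dots> = finsum U (\<lambda>p. c \<odot>\<^bsub>U\<^esub> (case p of (x, y) \<Rightarrow> f (x, y) \<odot>\<^bsub>U\<^esub> \<beta> x y)) ?A"
    apply (rule U.M.finsum_cong')
    using a assms by (auto simp: v Fmem bmem U.smult_assoc1)
  also have "\<dots> = c \<odot>\<^bsub>U\<^esub> ext f"
    unfolding ext_def
    apply (rule U.finsum_smult_ldistr[symmetric]) using a assms by (auto simp: Fmem bmem)
  finally show ?thesis .
qed

lemma ext_gen: assumes "x \<in> carrier V" "y \<in> carrier W"
  shows "ext (free_gen K (x,y)) = \<beta> x y"
proof -
  have "ext (free_gen K (x,y)) = finsum U (\<lambda>(x', y'). free_gen K (x,y) (x', y') \<odot>\<^bsub>U\<^esub> \<beta> x' y') {(x,y)}"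
    by (rule ext_sup) (use assms free_gen_mem in \<open>auto simp: free_gen_def\<close>)
  also have "\<dots> = \<beta> x y"
    using assms bmem by (subst U.M.finsum_insert) (auto simp: free_gen_def)
  finally show ?thesis .
qed

lemma ext_minus: assumes "f \<in> carrier F" "g \<in> carrier F"
  shows "ext (f \<ominus>\<^bsub>F\<^esub> g) = ext f \<ominus>\<^bsub>U\<^esub> ext g"
proof -
  have "ext (f \<ominus>\<^bsub>F\<^esub> g) \<oplus>\<^bsub>U\<^esub> ext g = ext f"
    using assms by (subst ext_add[symmetric]) (auto simp: a_minus_def F.M.a_assoc F.M.l_neg)
  then show ?thesis using assms
    by (metis F.M.minus_closed U.M.add.inv_solve_right ext_closed a_minus_def)
qed

lemma ext_N: assumes "f \<in> N" shows "ext f = \<zero>\<^bsub>U\<^esub>"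
proof -
  let ?H = "{f \<in> carrier F. ext f = \<zero>\<^bsub>U\<^esub>}"
  have z: "ext \<zero>\<^bsub>F\<^esub> = \<zero>\<^bsub>U\<^esub>" by (simp add: ext_def free_module_def)
  have "submodule ?H K F"
  proof (rule F.submoduleI)
    fix a assume "a \<in> ?H"
    then show "\<ominus>\<^bsub>F\<^esub> a \<in> ?H"
      using ext_minus[of "\<zero>\<^bsub>F\<^esub>" a] z by (auto simp: a_minus_def)
  qed (auto simp: z ext_add ext_smult)
  moreover have "tensor_relators K V W \<subseteq> ?H"
    using bil unfolding tensor_relators_def Let_def bilinear_maps_def linear_maps_def
    by (auto simp: free_gen_mem ext_minus ext_add ext_smult ext_gen bmem)
      (auto simp: a_minus_def U.M.r_neg bmem)
  ultimately show ?thesis using assms unfolding tensor_null_def by blast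
qed

lemma lift_q: assumes "f \<in> carrier F" shows "tensor_lift K U \<beta> (q f) = ext f"
proof -
  have "ext g = ext f" if "g \<in> q f" for g
  proof -
    have g: "g \<in> carrier F" "g \<ominus>\<^bsub>F\<^esub> f \<in> N" using q_mem[OF assms that] q_eq assms by auto
    then have "g = (g \<ominus>\<^bsub>F\<^esub> f) \<oplus>\<^bsub>F\<^esub> f"
      using assms by (simp add: a_minus_def F.M.a_assoc F.M.l_neg)
    then have "ext g = ext (g \<ominus>\<^bsub>F\<^esub> f) \<oplus>\<^bsub>U\<^esub> ext f"
      using ext_add[of "g \<ominus>\<^bsub>F\<^esub> f" f] g assms by auto
    then show ?thesis using ext_N[OF g(2)] assms ext_closed by simp
  qed
  moreover have "f \<in> q f" using a_rcos_self assms by auto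
  ultimately show ?thesis unfolding tensor_lift_def ext_def[symmetric]
    by (intro the_equality) metis+
qed

theorem lift_linear: "tensor_lift K U \<beta> \<in> linear_maps K T U"
  by (auto simp: linear_maps_def carT q_add q_smult lift_q ext_add ext_smult ext_closed)

theorem lift_pure: "x \<in> carrier V \<Longrightarrow> y \<in> carrier W \<Longrightarrow> tensor_lift K U \<beta> (pure_tensor K V W x y) = \<beta> x y"
  by (simp add: pure_tensor_def lift_q free_gen_mem ext_gen)

end


section \<open>Coalgebras and bialgebras\<close>

text \<open>
  In the counit laws, \<open>(\<epsilon> \<otimes> id) \<Delta>\<close> and \<open>(id \<otimes> \<epsilon>) \<Delta>\<close> are composed with the canonical
  isomorphisms \<open>K \<otimes> C \<cong> C\<close> and \<open>C \<otimes> K \<cong> C\<close>.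
\<close>

locale coalgebra = field K + module K C
  for K :: "('k, 'm) ring_scheme" (structure) and C :: "('k, 'c, 'n) module_scheme" (structure) +
  fixes \<Delta> :: "'c \<Rightarrow> ('c \<times> 'c \<Rightarrow> 'k) set" and \<epsilon> :: "'c \<Rightarrow> 'k"
  assumes comult_linear: "\<Delta> \<in> linear_maps K C (tensor_module K C C)"
    and counit_linear: "\<epsilon> \<in> linear_maps K C (regular_algebra K)"
    and coassoc: "x \<in> carrier C \<Longrightarrow>
      tensor_assoc K C C C (tensor_map K (tensor_module K C C) C \<Delta> (\<lambda>y. y) (\<Delta> x)) =
      tensor_map K C (tensor_module K C C) (\<lambda>y. y) \<Delta> (\<Delta> x)"
    and counit_left: "x \<in> carrier C \<Longrightarrow>
      tensor_lift K C (\<lambda>c y. c \<odot>\<^bsub>C\<^esub> y)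
        (tensor_map K (regular_algebra K) C \<epsilon> (\<lambda>y. y) (\<Delta> x)) = x"
    and counit_right: "x \<in> carrier C \<Longrightarrow>
      tensor_lift K C (\<lambda>y c. c \<odot>\<^bsub>C\<^esub> y)
        (tensor_map K C (regular_algebra K) (\<lambda>y. y) \<epsilon> (\<Delta> x)) = x"

locale bialgebra = assoc_algebra K B + coalgebra K B \<Delta> \<epsilon>
  for K :: "('k, 'm) ring_scheme" (structure) and B :: "('k, 'b, 'n) module_scheme" (structure)
    and \<Delta> \<epsilon> +
  assumes comult_hom: "\<Delta> \<in> algebra_homs K B (tensor_algebra K B B)"
    and counit_hom: "\<epsilon> \<in> algebra_homs K B (regular_algebra K)"


section \<open>The split algebra on n idempotents\<close>

definition split_algebra :: "('k, 'm) ring_scheme \<Rightarrow> nat \<Rightarrow> ('k, nat \<Rightarrow> 'k) module"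
  where "split_algebra K n =
    \<lparr>carrier = {1..n} \<rightarrow>\<^sub>E carrier K,
     monoid.mult = (\<lambda>x y. \<lambda>i\<in>{1..n}. x i \<otimes>\<^bsub>K\<^esub> y i),
     one = (\<lambda>i\<in>{1..n}. \<one>\<^bsub>K\<^esub>),
     zero = (\<lambda>i\<in>{1..n}. \<zero>\<^bsub>K\<^esub>),
     add = (\<lambda>x y. \<lambda>i\<in>{1..n}. x i \<oplus>\<^bsub>K\<^esub> y i),
     smult = (\<lambda>c x. \<lambda>i\<in>{1..n}. c \<otimes>\<^bsub>K\<^esub> x i)\<rparr>"

definition idem :: "('k, 'm) ring_scheme \<Rightarrow> nat \<Rightarrow> nat \<Rightarrow> (nat \<Rightarrow> 'k)"
  where "idem K n i = (\<lambda>j\<in>{1..n}. if j = i then \<one>\<^bsub>K\<^esub> else \<zero>\<^bsub>K\<^esub>)"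

text \<open>
  The linear maps prescribed on the idempotents by a binary operation \<open>f\<close> on \<open>{1..n}\<close>
  and an element u.
\<close>

definition comult_counit_of ::
    "('k, 'm) ring_scheme \<Rightarrow> nat \<Rightarrow> (nat \<Rightarrow> nat \<Rightarrow> nat) \<Rightarrow> nat \<Rightarrow>
     ((nat \<Rightarrow> 'k) \<Rightarrow> ((nat \<Rightarrow> 'k) \<times> (nat \<Rightarrow> 'k) \<Rightarrow> 'k) set) \<Rightarrow> ((nat \<Rightarrow> 'k) \<Rightarrow> 'k) \<Rightarrow> bool"
  where "comult_counit_of K n f u \<Delta> \<epsilon> \<longleftrightarrow>
    (let B = split_algebra K n; e = idem K n in
      \<Delta> \<in> linear_maps K B (tensor_algebra K B B) \<and>
      \<epsilon> \<in> linear_maps K B (regular_algebra K) \<and>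
      (\<forall>i\<in>{1..n}. \<Delta> (e i) =
         finsum (tensor_algebra K B B) (\<lambda>(k, l). pure_tensor K B B (e k) (e l))
           {(k, l) \<in> {1..n} \<times> {1..n}. f k l = i}) \<and>
      (\<forall>i\<in>{1..n}. \<epsilon> (e i) = (if i = u then \<one>\<^bsub>K\<^esub> else \<zero>\<^bsub>K\<^esub>)))"

end

theory Submission
  imports Defs
begin

text \<open>
  Read \<open>B = K\<^sup>n\<close> as the algebra of K-valued functions on \<open>S = {1..n}\<close>, so that \<open>B \<otimes> B\<close> and
  \<open>B \<otimes> B \<otimes> B\<close> are the algebras of functions on \<open>S \<times> S\<close> and \<open>S \<times> S \<times> S\<close>, with pointwise
  operations. A map \<open>f : S \<times> S \<rightarrow> S\<close> and a point \<open>u \<in> S\<close> define algebra maps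
  \<open>\<Delta> : B \<rightarrow> B \<otimes> B\<close> and \<open>\<epsilon> : B \<rightarrow> K\<close> by pullback, \<open>(\<Delta> x)\<^sub>i\<^sub>j = x (f i j)\<close> and \<open>\<epsilon> x = x u\<close>. Under
  pullback, coassociativity becomes associativity of f and the counit laws become the unit laws
  for u, since functions on S separate its points (\<open>bialgebra_iff_monoid\<close>). This settles part (b):
  the maps prescribed on the \<open>e\<^sub>i\<close> are exactly these pullbacks (\<open>comult_counit_of_iff_dualizes\<close>).

  For part (a) it remains to see that the structure maps of any bialgebra are pullbacks. This
  holds because the only algebra maps \<open>B \<rightarrow> K\<close> are the evaluations at the points of S
  (\<open>algebra_hom_is_value\<close>), applied to \<open>\<epsilon>\<close> and to all \<open>x \<mapsto> (\<Delta> x)\<^sub>i\<^sub>j\<close> (\<open>bialgebra_dualizes\<close>). The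
  structure constant \<open>a\<^sub>i\<^sub>j\<^sup>k\<close> is then \<open>e\<^sub>k (f i j)\<close>, which is 1 for \<open>k = f i j\<close> and 0 otherwise.

  The identification of a tensor with its array of entries is obtained from linear maps out of
  the tensor product. Such maps are determined by their values on pure tensors, and each
  \<open>X \<in> B \<otimes> W\<close> equals \<open>\<Sum>\<^sub>i e\<^sub>i \<otimes> X\<^sub>i\<close> for its slices \<open>X\<^sub>i \<in> W\<close> (\<open>slice_expansion\<close>).
\<close>


section \<open>Linear maps\<close>

lemma linear_mapsI:
  assumes "\<And>x. x \<in> carrier V \<Longrightarrow> f x \<in> carrier W"
    and "\<And>x y. x \<in> carrier V \<Longrightarrow> y \<in> carrier V \<Longrightarrow> f (x \<oplus>\<^bsub>V\<^esub> y) = f x \<oplus>\<^bsub>W\<^esub> f y"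
    and "\<And>c x. c \<in> carrier K \<Longrightarrow> x \<in> carrier V \<Longrightarrow> f (c \<odot>\<^bsub>V\<^esub> x) = c \<odot>\<^bsub>W\<^esub> f x"
  shows "f \<in> linear_maps K V W"
  using assms by (auto simp: linear_maps_def)

lemma linear_maps_closed: "f \<in> linear_maps K V W \<Longrightarrow> x \<in> carrier V \<Longrightarrow> f x \<in> carrier W"
  by (auto simp: linear_maps_def)

lemma linear_maps_add:
  "f \<in> linear_maps K V W \<Longrightarrow> x \<in> carrier V \<Longrightarrow> y \<in> carrier V \<Longrightarrow> f (x \<oplus>\<^bsub>V\<^esub> y) = f x \<oplus>\<^bsub>W\<^esub> f y"
  by (auto simp: linear_maps_def)

lemma linear_maps_smult:
  "f \<in> linear_maps K V W \<Longrightarrow> c \<in> carrier K \<Longrightarrow> x \<in> carrier V \<Longrightarrow> f (c \<odot>\<^bsub>V\<^esub> x) = c \<odot>\<^bsub>W\<^esub> f x"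
  by (auto simp: linear_maps_def)

lemmas linear_maps_simps = linear_maps_closed linear_maps_add linear_maps_smult

lemma linear_maps_zero:
  assumes "module K V" "module K W" "f \<in> linear_maps K V W"
  shows "f \<zero>\<^bsub>V\<^esub> = \<zero>\<^bsub>W\<^esub>"
proof -
  interpret V: module K V by fact
  interpret W: module K W by fact
  have "f (\<zero>\<^bsub>K\<^esub> \<odot>\<^bsub>V\<^esub> \<zero>\<^bsub>V\<^esub>) = \<zero>\<^bsub>K\<^esub> \<odot>\<^bsub>W\<^esub> f \<zero>\<^bsub>V\<^esub>"
    using assms(3) by (intro linear_maps_smult) auto
  then show ?thesis using linear_maps_closed[OF assms(3)] by simp
qed

lemma linear_maps_finsum:
  assumes "module K V" "module K W" "f \<in> linear_maps K V W" "g \<in> A \<rightarrow> carrier V"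
  shows "f (finsum V g A) = finsum W (\<lambda>i. f (g i)) A"
proof -
  interpret V: module K V by fact
  interpret W: module K W by fact
  show ?thesis
    using assms(4)
  proof (induction A rule: infinite_finite_induct)
    case (insert a A)
    then have "g a \<in> carrier V" "g \<in> A \<rightarrow> carrier V" by auto
    with insert assms(3) show ?case
      by (simp add: V.finsum_insert W.finsum_insert linear_maps_simps Pi_iff)
  qed (auto simp: linear_maps_zero[OF assms(1-3)] V.finsum_infinite W.finsum_infinite)
qed

lemma linear_maps_comp:
  "g \<in> linear_maps K W U \<Longrightarrow> f \<in> linear_maps K V W \<Longrightarrow> (\<lambda>x. g (f x)) \<in> linear_maps K V U"
  by (intro linear_mapsI) (simp_all add: linear_maps_simps)

lemma linear_maps_id: "(\<lambda>x. x) \<in> linear_maps K V V"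
  by (auto simp: linear_maps_def)

lemma bilinear_mapsI:
  assumes "\<And>x. x \<in> carrier V \<Longrightarrow> \<beta> x \<in> linear_maps K W U"
    and "\<And>y. y \<in> carrier W \<Longrightarrow> (\<lambda>x. \<beta> x y) \<in> linear_maps K V U"
  shows "\<beta> \<in> bilinear_maps K V W U"
  using assms by (auto simp: bilinear_maps_def)

lemma bilinear_maps_left: "\<beta> \<in> bilinear_maps K V W U \<Longrightarrow> y \<in> carrier W \<Longrightarrow> (\<lambda>x. \<beta> x y) \<in> linear_maps K V U"
  by (auto simp: bilinear_maps_def)

lemma bilinear_maps_right: "\<beta> \<in> bilinear_maps K V W U \<Longrightarrow> x \<in> carrier V \<Longrightarrow> \<beta> x \<in> linear_maps K W U"
  by (auto simp: bilinear_maps_def)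

lemma bilinear_maps_comp:
  assumes "\<beta> \<in> bilinear_maps K V' W' U" "f \<in> linear_maps K V V'" "g \<in> linear_maps K W W'"
  shows "(\<lambda>x y. \<beta> (f x) (g y)) \<in> bilinear_maps K V W U"
proof (rule bilinear_mapsI)
  fix x assume "x \<in> carrier V"
  then show "(\<lambda>y. \<beta> (f x) (g y)) \<in> linear_maps K W U"
    by (intro linear_maps_comp[OF bilinear_maps_right[OF assms(1)] assms(3)] linear_maps_closed[OF assms(2)])
next
  fix y assume "y \<in> carrier W"
  then show "(\<lambda>x. \<beta> (f x) (g y)) \<in> linear_maps K V U"
    by (intro linear_maps_comp[OF bilinear_maps_left[OF assms(1)] assms(2)] linear_maps_closed[OF assms(3)])
qed

lemma bilinear_maps_flip: "\<beta> \<in> bilinear_maps K V W U \<Longrightarrow> (\<lambda>y x. \<beta> x y) \<in> bilinear_maps K W V U"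
  by (auto simp: bilinear_maps_def)

lemma smult_bilinear:
  assumes "module K V"
  shows "(\<lambda>c y. c \<odot>\<^bsub>V\<^esub> y) \<in> bilinear_maps K (regular_algebra K) V V"
proof -
  interpret module K V by fact
  show ?thesis
    by (intro bilinear_mapsI linear_mapsI)
      (auto simp: regular_algebra_def smult_l_distr smult_r_distr smult_assoc1[symmetric] R.m_comm)
qed

lemma regular_module:
  assumes "cring K" shows "module K (regular_algebra K)"
proof -
  interpret cring K by fact
  show ?thesis
    by (intro moduleI abelian_groupI)
      (auto simp: regular_algebra_def a_ac l_distr r_distr m_assoc assms intro: bexI[of _ "\<ominus>\<^bsub>K\<^esub> _"] l_neg)
qed

lemma regular_algebra_simps [simp]:
  "carrier (regular_algebra K) = carrier K" "add (regular_algebra K) = add K"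
  "zero (regular_algebra K) = zero K" "smult (regular_algebra K) = mult K"
  "mult (regular_algebra K) = mult K" "one (regular_algebra K) = one K"
  by (simp_all add: regular_algebra_def)

lemma finsum_regular_algebra:
  assumes "cring K" "g \<in> A \<rightarrow> carrier K"
  shows "finsum (regular_algebra K) g A = finsum K g A"
proof -
  interpret K: cring K by fact
  interpret R: module K "regular_algebra K" by (rule regular_module) fact
  show ?thesis using assms(2)
  proof (induction A rule: infinite_finite_induct)
    case (insert a A)
    then have "g a \<in> carrier K" "g \<in> A \<rightarrow> carrier K" by auto
    with insert show ?case by (simp add: K.finsum_insert R.finsum_insert)
  qed (simp_all add: K.finsum_infinite R.finsum_infinite)
qed

lemma algebra_homs_comp:
  "g \<in> algebra_homs K B C \<Longrightarrow> f \<in> algebra_homs K A B \<Longrightarrow> (\<lambda>x. g (f x)) \<in> algebra_homs K A C"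
  using linear_maps_comp[of g K B C f A] by (auto simp: algebra_homs_def ring_hom_def Pi_iff)


section \<open>Maps out of a tensor product\<close>

context tensor_of_modules
begin

lemma pure_closed: "x \<in> carrier V \<Longrightarrow> y \<in> carrier W \<Longrightarrow> pure_tensor K V W x y \<in> carrier T"
  using pure_bilinear by (auto dest: bilinear_maps_left linear_maps_closed)

text \<open>
  A formal sum with finite support is built up from its terms one support point at a time. There
  is no case for zero, since \<open>0 = 0 (0 \<otimes> 0)\<close> falls under scalar multiples.
\<close>

lemma tensor_induct [consumes 1, case_names pure add smult]:
  assumes X: "X \<in> carrier T"
    and pure: "\<And>x y. x \<in> carrier V \<Longrightarrow> y \<in> carrier W \<Longrightarrow> P (pure_tensor K V W x y)"
    and add: "\<And>X Y. \<lbrakk>X \<in> carrier T; Y \<in> carrier T; P X; P Y\<rbrakk> \<Longrightarrow> P (X \<oplus>\<^bsub>T\<^esub> Y)"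
    and smult: "\<And>c X. \<lbrakk>c \<in> carrier K; X \<in> carrier T; P X\<rbrakk> \<Longrightarrow> P (c \<odot>\<^bsub>T\<^esub> X)"
  shows "P X"
proof -
  have gen: "P (q (c \<odot>\<^bsub>F\<^esub> free_gen K p))" if "p \<in> carrier V \<times> carrier W" "c \<in> carrier K" for c p
    using that smult[OF that(2) pure_closed pure]
    by (cases p) (auto simp: pure_tensor_def q_smult free_gen_mem)
  have "P (q f)" if "finite A" "A \<subseteq> carrier V \<times> carrier W" "f \<in> carrier F" "{p. f p \<noteq> \<zero>} \<subseteq> A" for A f
    using that
  proof (induction A arbitrary: f rule: finite_induct)
    case empty
    then have "f = \<zero> \<odot>\<^bsub>F\<^esub> free_gen K (\<zero>\<^bsub>V\<^esub>, \<zero>\<^bsub>W\<^esub>)"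
      by (auto simp: free_module_def free_gen_def fun_eq_iff)
    then show ?case using gen by auto
  next
    case (insert p A)
    define g where "g = f(p := \<zero>)"
    have sub: "{r. g r \<noteq> \<zero>} \<subseteq> {r. f r \<noteq> \<zero>}" "{r. g r \<noteq> \<zero>} \<subseteq> A"
      using insert.prems(3) by (auto simp: g_def)
    then have g: "g \<in> carrier F"
      using insert.prems(2) finite_subset[OF sub(1)] by (auto simp: free_module_def g_def image_subset_iff)
    have fp: "f p \<in> carrier K" using insert.prems(2) by (auto simp: free_module_def)
    have fr: "f r \<in> carrier K" for r using insert.prems(2) by (auto simp: free_module_def)
    have p: "p \<in> carrier V \<times> carrier W" using insert.prems by auto
    have "f = g \<oplus>\<^bsub>F\<^esub> f p \<odot>\<^bsub>F\<^esub> free_gen K p"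
      by (auto simp: free_module_def free_gen_def g_def fun_eq_iff fr)
    moreover have d: "free_gen K p \<in> carrier F" using p by (auto simp: free_gen_mem)
    ultimately have "q f = q g \<oplus>\<^bsub>T\<^esub> q (f p \<odot>\<^bsub>F\<^esub> free_gen K p)"
      using g fp by (simp add: q_add)
    moreover have "P (q g)" using insert.IH[of g] insert.prems(1) g sub by auto
    ultimately show ?case
      using gen[OF p fp] g fp d add by (auto simp: carT)
  qed
  moreover obtain f where "f \<in> carrier F" "X = q f" using X by (auto simp: carT)
  ultimately show ?thesis
    by (auto simp: free_module_def)
qed

lemma linear_maps_eq_on_tensor:
  assumes "g \<in> linear_maps K T U" "h \<in> linear_maps K T U" "X \<in> carrier T"
    and "\<And>x y. x \<in> carrier V \<Longrightarrow> y \<in> carrier W \<Longrightarrow> g (pure_tensor K V W x y) = h (pure_tensor K V W x y)"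
  shows "g X = h X"
  using assms(3) by (induction rule: tensor_induct) (auto simp: assms linear_maps_simps[OF assms(1)] linear_maps_simps[OF assms(2)])

lemma tensor_lift_linear:
  assumes "module K U" "\<beta> \<in> bilinear_maps K V W U"
  shows "tensor_lift K U \<beta> \<in> linear_maps K T U"
proof -
  interpret U: module K U by fact
  interpret bilinear_on_tensor K V W U \<beta> by unfold_locales fact
  show ?thesis by (rule lift_linear)
qed

lemma tensor_lift_pure:
  assumes "module K U" "\<beta> \<in> bilinear_maps K V W U" "x \<in> carrier V" "y \<in> carrier W"
  shows "tensor_lift K U \<beta> (pure_tensor K V W x y) = \<beta> x y"
proof -
  interpret U: module K U by fact
  interpret bilinear_on_tensor K V W U \<beta> by unfold_locales fact
  show ?thesis using assms by (simp add: lift_pure)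
qed

text \<open>
  Linearity of a lift in a parameter of the bilinear map. Two-step constructions such as the
  associator and the multiplication on a tensor product lift a map that is itself a lift; this
  lemma supplies the bilinearity which the outer lift requires.
\<close>

lemma tensor_lift_linear_param:
  assumes U: "module K U" and X: "X \<in> carrier T"
    and bil: "\<And>p. p \<in> carrier P \<Longrightarrow> \<beta> p \<in> bilinear_maps K V W U"
    and lin: "\<And>x y. x \<in> carrier V \<Longrightarrow> y \<in> carrier W \<Longrightarrow> (\<lambda>p. \<beta> p x y) \<in> linear_maps K P U"
    and P: "module K P"
  shows "(\<lambda>p. tensor_lift K U (\<beta> p) X) \<in> linear_maps K P U"
proof -
  interpret U: module K U by fact
  interpret P: module K P by fact
  note l = linear_maps_simps[OF tensor_lift_linear[OF U bil]]
  note p = tensor_lift_pure[OF U bil]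
  show ?thesis
  proof (rule linear_mapsI)
    fix a b assume [simp]: "a \<in> carrier P" "b \<in> carrier P"
    show "tensor_lift K U (\<beta> (a \<oplus>\<^bsub>P\<^esub> b)) X = tensor_lift K U (\<beta> a) X \<oplus>\<^bsub>U\<^esub> tensor_lift K U (\<beta> b) X"
      using X by (induction rule: tensor_induct)
        (simp_all add: p l linear_maps_add[OF lin] U.a_ac U.smult_r_distr)
  next
    fix c a assume [simp]: "c \<in> carrier K" "a \<in> carrier P"
    show "tensor_lift K U (\<beta> (c \<odot>\<^bsub>P\<^esub> a)) X = c \<odot>\<^bsub>U\<^esub> tensor_lift K U (\<beta> a) X"
      using X by (induction rule: tensor_induct)
        (simp_all add: p l linear_maps_smult[OF lin] U.smult_r_distr U.smult_assoc1[symmetric] V.m_comm)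
  qed (simp add: l X)
qed

end

lemma tensor_map:
  assumes "module K V" "module K W" "module K V'" "module K W'"
    and "f \<in> linear_maps K V V'" "g \<in> linear_maps K W W'"
  shows tensor_map_linear: "tensor_map K V' W' f g \<in> linear_maps K (tensor_module K V W) (tensor_module K V' W')"
    and tensor_map_pure: "x \<in> carrier V \<Longrightarrow> y \<in> carrier W \<Longrightarrow>
      tensor_map K V' W' f g (pure_tensor K V W x y) = pure_tensor K V' W' (f x) (g y)"
proof -
  interpret S: tensor_of_modules K V W using assms by (simp add: tensor_of_modules_def)
  interpret T: tensor_of_modules K V' W' using assms by (simp add: tensor_of_modules_def)
  note b = bilinear_maps_comp[OF T.pure_bilinear assms(5,6)]
  show "tensor_map K V' W' f g \<in> linear_maps K S.T T.T"
    and "x \<in> carrier V \<Longrightarrow> y \<in> carrier W \<Longrightarrow>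
      tensor_map K V' W' f g (pure_tensor K V W x y) = pure_tensor K V' W' (f x) (g y)"
    unfolding tensor_map_def
    using S.tensor_lift_linear[OF T.tensor_module_module b] S.tensor_lift_pure[OF T.tensor_module_module b]
    by auto
qed

lemma tensor_assoc:
  assumes "module K U" "module K V" "module K W"
  shows tensor_assoc_linear: "tensor_assoc K U V W \<in> linear_maps K (tensor_module K (tensor_module K U V) W)
      (tensor_module K U (tensor_module K V W))" (is ?lin)
    and tensor_assoc_pure: "x \<in> carrier U \<Longrightarrow> y \<in> carrier V \<Longrightarrow> z \<in> carrier W \<Longrightarrow>
      tensor_assoc K U V W (pure_tensor K (tensor_module K U V) W (pure_tensor K U V x y) z) =
      pure_tensor K U (tensor_module K V W) x (pure_tensor K V W y z)" (is "_ \<Longrightarrow> _ \<Longrightarrow> _ \<Longrightarrow> ?pure")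
proof -
  interpret UV: tensor_of_modules K U V using assms by (simp add: tensor_of_modules_def)
  interpret VW: tensor_of_modules K V W using assms by (simp add: tensor_of_modules_def)
  interpret L: tensor_of_modules K UV.T W
    using assms UV.tensor_module_module by (simp add: tensor_of_modules_def)
  interpret R: tensor_of_modules K U VW.T
    using assms VW.tensor_module_module by (simp add: tensor_of_modules_def)
  let ?\<gamma> = "\<lambda>z x y. pure_tensor K U VW.T x (pure_tensor K V W y z)"
  have \<gamma>: "?\<gamma> z \<in> bilinear_maps K U V R.T" if "z \<in> carrier W" for z
    using that by (intro bilinear_maps_comp[OF R.pure_bilinear linear_maps_id bilinear_maps_left[OF VW.pure_bilinear]])
  have \<gamma>z: "(\<lambda>z. ?\<gamma> z x y) \<in> linear_maps K W R.T" if "x \<in> carrier U" "y \<in> carrier V" for x y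
    using that by (intro linear_maps_comp[OF bilinear_maps_right[OF R.pure_bilinear] bilinear_maps_right[OF VW.pure_bilinear]])
  let ?\<beta> = "\<lambda>X z. tensor_lift K R.T (?\<gamma> z) X"
  have \<beta>: "?\<beta> \<in> bilinear_maps K UV.T W R.T"
    by (intro bilinear_mapsI UV.tensor_lift_linear_param UV.tensor_lift_linear R.tensor_module_module \<gamma> \<gamma>z assms)
  have e: "tensor_assoc K U V W = tensor_lift K R.T ?\<beta>"
    by (simp add: tensor_assoc_def Let_def)
  show ?lin unfolding e by (rule L.tensor_lift_linear[OF R.tensor_module_module \<beta>])
  assume "x \<in> carrier U" "y \<in> carrier V" "z \<in> carrier W"
  then show ?pure unfolding e
    by (simp add: L.tensor_lift_pure[OF R.tensor_module_module \<beta>] UV.pure_closed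
        UV.tensor_lift_pure[OF R.tensor_module_module \<gamma>])
qed

lemma tensor_algebra_simps [simp]:
  "carrier (tensor_algebra K A B) = carrier (tensor_module K A B)"
  "add (tensor_algebra K A B) = add (tensor_module K A B)"
  "zero (tensor_algebra K A B) = zero (tensor_module K A B)"
  "smult (tensor_algebra K A B) = smult (tensor_module K A B)"
  "one (tensor_algebra K A B) = pure_tensor K A B \<one>\<^bsub>A\<^esub> \<one>\<^bsub>B\<^esub>"
  by (simp_all add: tensor_algebra_def Let_def)

text \<open>
  The tensor algebra differs from the tensor module only in its multiplication and unit, so
  everything that depends on the linear structure alone carries over.
\<close>

lemma linear_maps_tensor_algebra:
  "linear_maps K V (tensor_algebra K A B) = linear_maps K V (tensor_module K A B)"
  by (simp add: linear_maps_def)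

lemma finsum_tensor_algebra: "finsum (tensor_algebra K A B) = finsum (tensor_module K A B)"
  by (simp add: finsum_def fun_eq_iff)

lemma assoc_algebra_mult_bilinear:
  assumes "assoc_algebra K A"
  shows "mult A \<in> bilinear_maps K A A A"
proof -
  interpret assoc_algebra K A by fact
  show ?thesis
    by (intro bilinear_mapsI linear_mapsI) (auto simp: l_distr r_distr smult_mult_left smult_mult_right)
qed

lemma tensor_algebra_mult:
  assumes A: "assoc_algebra K A" and B: "assoc_algebra K B"
  shows tensor_algebra_mult_bilinear: "mult (tensor_algebra K A B) \<in>
      bilinear_maps K (tensor_module K A B) (tensor_module K A B) (tensor_module K A B)" (is ?bil)
    and tensor_algebra_mult_pure: "\<lbrakk>a \<in> carrier A; b \<in> carrier B; c \<in> carrier A; d \<in> carrier B\<rbrakk> \<Longrightarrow>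
      pure_tensor K A B a b \<otimes>\<^bsub>tensor_algebra K A B\<^esub> pure_tensor K A B c d =
      pure_tensor K A B (a \<otimes>\<^bsub>A\<^esub> c) (b \<otimes>\<^bsub>B\<^esub> d)" (is "_ \<Longrightarrow> _ \<Longrightarrow> _ \<Longrightarrow> _ \<Longrightarrow> ?pure")
proof -
  have mA: "module K A" and mB: "module K B"
    using A B by (auto simp: assoc_algebra_def)
  interpret T: tensor_of_modules K A B using mA mB by (simp add: tensor_of_modules_def)
  note bA = assoc_algebra_mult_bilinear[OF A] and bB = assoc_algebra_mult_bilinear[OF B]
  note T = T.tensor_module_module
  let ?\<gamma> = "\<lambda>a b c d. pure_tensor K A B (a \<otimes>\<^bsub>A\<^esub> c) (b \<otimes>\<^bsub>B\<^esub> d)"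
  have \<gamma>: "?\<gamma> a b \<in> bilinear_maps K A B T.T" if "a \<in> carrier A" "b \<in> carrier B" for a b
    using that by (intro bilinear_maps_comp[OF T.pure_bilinear] bilinear_maps_right[OF bA] bilinear_maps_right[OF bB])
  have \<gamma>': "(\<lambda>a b. ?\<gamma> a b c d) \<in> bilinear_maps K A B T.T" if "c \<in> carrier A" "d \<in> carrier B" for c d
    using that by (intro bilinear_maps_comp[OF T.pure_bilinear] bilinear_maps_left[OF bA] bilinear_maps_left[OF bB])
  let ?\<beta> = "\<lambda>Y a b. tensor_lift K T.T (?\<gamma> a b) Y"
  have \<beta>: "?\<beta> Y \<in> bilinear_maps K A B T.T" if "Y \<in> carrier T.T" for Y
  proof (rule bilinear_mapsI)
    fix a assume a: "a \<in> carrier A"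
    show "(\<lambda>b. ?\<beta> Y a b) \<in> linear_maps K B T.T"
      by (rule T.tensor_lift_linear_param[OF T that \<gamma>[OF a] bilinear_maps_right[OF \<gamma>' a] mB])
  next
    fix b assume b: "b \<in> carrier B"
    show "(\<lambda>a. ?\<beta> Y a b) \<in> linear_maps K A T.T"
      by (rule T.tensor_lift_linear_param[OF T that \<gamma>[OF _ b] bilinear_maps_left[OF \<gamma>' b] mA])
  qed
  have e: "mult (tensor_algebra K A B) = (\<lambda>X Y. tensor_lift K T.T (?\<beta> Y) X)"
    by (simp add: tensor_algebra_def Let_def)
  show ?bil unfolding e
    by (intro bilinear_mapsI T.tensor_lift_linear_param T.tensor_lift_linear \<beta> T \<gamma>)
  assume "a \<in> carrier A" "b \<in> carrier B" "c \<in> carrier A" "d \<in> carrier B"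
  then show ?pure unfolding e
    by (simp add: T.tensor_lift_pure[OF T \<beta>] T.tensor_lift_pure[OF T \<gamma>] T.pure_closed)
qed


section \<open>The split algebra\<close>

locale split_algebra_over = cring K for K (structure) + fixes n :: nat
begin

\<comment> \<open>The simplifier would otherwise rewrite \<open>{1..n}\<close> to \<open>{Suc 0..n}\<close> and miss facts stated with S.\<close>
declare One_nat_def [simp del]

abbreviation "S \<equiv> {1..n}"
abbreviation "B \<equiv> split_algebra K n"
abbreviation "e \<equiv> idem K n"
abbreviation "BB \<equiv> tensor_module K B B"
abbreviation "R \<equiv> regular_algebra K"

lemma op_closed:
  "x \<in> carrier B \<Longrightarrow> y \<in> carrier B \<Longrightarrow> x \<otimes>\<^bsub>B\<^esub> y \<in> carrier B" "\<one>\<^bsub>B\<^esub> \<in> carrier B"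
  "x \<in> carrier B \<Longrightarrow> y \<in> carrier B \<Longrightarrow> x \<oplus>\<^bsub>B\<^esub> y \<in> carrier B" "\<zero>\<^bsub>B\<^esub> \<in> carrier B"
  "c \<in> carrier K \<Longrightarrow> x \<in> carrier B \<Longrightarrow> c \<odot>\<^bsub>B\<^esub> x \<in> carrier B"
  "(\<And>i. i \<in> S \<Longrightarrow> g i \<in> carrier K) \<Longrightarrow> restrict g S \<in> carrier B"
  by (simp_all add: split_algebra_def PiE_iff)

lemma op_value:
  assumes "i \<in> S"
  shows "(x \<otimes>\<^bsub>B\<^esub> y) i = x i \<otimes> y i" "\<one>\<^bsub>B\<^esub> i = \<one>" "(x \<oplus>\<^bsub>B\<^esub> y) i = x i \<oplus> y i" "\<zero>\<^bsub>B\<^esub> i = \<zero>"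
    "(c \<odot>\<^bsub>B\<^esub> x) i = c \<otimes> x i"
  using assms by (simp_all add: split_algebra_def)

lemma value_closed: "x \<in> carrier B \<Longrightarrow> i \<in> S \<Longrightarrow> x i \<in> carrier K"
  by (auto simp: split_algebra_def)

lemma split_eqI:
  assumes "x \<in> carrier B" "y \<in> carrier B" "\<And>i. i \<in> S \<Longrightarrow> x i = y i"
  shows "x = y"
  using assms by (auto simp: split_algebra_def intro: PiE_ext)

lemma idem_closed: "e i \<in> carrier B"
  by (auto simp: split_algebra_def idem_def)

lemma idem_value: "j \<in> S \<Longrightarrow> e i j = (if j = i then \<one> else \<zero>)"
  by (simp add: idem_def)

lemma split_module: "module K B"
proof (intro moduleI abelian_groupI)
  fix x assume x: "x \<in> carrier B"
  have y: "(\<lambda>i\<in>S. \<ominus> x i) \<in> carrier B"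
    by (rule op_closed(6)) (simp add: value_closed[OF x])
  show "\<exists>y\<in>carrier B. y \<oplus>\<^bsub>B\<^esub> x = \<zero>\<^bsub>B\<^esub>"
    using x y by (intro bexI[OF _ y] split_eqI) (simp_all add: op_closed(1-5) op_value value_closed l_neg)
qed (rule split_eqI is_cring | simp add: op_closed op_value value_closed l_distr r_distr m_assoc a_ac)+

sublocale B: module K B by (rule split_module)

lemma split_assoc_algebra: "assoc_algebra K B"
proof -
  have "Ring.ring B"
    by (intro ringI B.M.abelian_group_axioms monoidI)
      (rule split_eqI | simp add: op_closed op_value value_closed l_distr r_distr m_assoc)+
  then show ?thesis
    by (intro assoc_algebra.intro split_module assoc_algebra_axioms.intro)
      (rule split_eqI | simp add: op_closed op_value value_closed m_ac)+
qed

lemma value_linear: "i \<in> S \<Longrightarrow> (\<lambda>x. x i) \<in> linear_maps K B R"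
  by (intro linear_mapsI) (simp_all add: value_closed op_value)

lemma idem_expansion:
  assumes "x \<in> carrier B"
  shows "finsum B (\<lambda>i. x i \<odot>\<^bsub>B\<^esub> e i) S = x"
proof (rule split_eqI)
  have c: "(\<lambda>i. x i \<odot>\<^bsub>B\<^esub> e i) \<in> S \<rightarrow> carrier B"
    using assms by (auto simp: value_closed idem_closed)
  then show "finsum B (\<lambda>i. x i \<odot>\<^bsub>B\<^esub> e i) S \<in> carrier B" by simp
  fix j assume j: "j \<in> S"
  have "finsum B (\<lambda>i. x i \<odot>\<^bsub>B\<^esub> e i) S j = finsum K (\<lambda>i. (x i \<odot>\<^bsub>B\<^esub> e i) j) S"
    using linear_maps_finsum[OF split_module regular_module[OF is_cring] value_linear[OF j] c] c j
    by (simp add: finsum_regular_algebra is_cring value_closed Pi_iff)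
  also have "\<dots> = finsum K (\<lambda>i. if j = i then x i else \<zero>) S"
    using assms j by (intro finsum_cong') (auto simp: op_value value_closed idem_value)
  also have "\<dots> = x j"
    using assms j by (intro finsum_singleton) (auto simp: value_closed)
  finally show "finsum B (\<lambda>i. x i \<odot>\<^bsub>B\<^esub> e i) S j = x j" .
qed (rule assms)

lemma linear_maps_eq_on_idems:
  assumes "module K U" "g \<in> linear_maps K B U" "h \<in> linear_maps K B U" "x \<in> carrier B"
    and "\<And>i. i \<in> S \<Longrightarrow> g (e i) = h (e i)"
  shows "g x = h x"
proof -
  interpret U: module K U by fact
  have c: "(\<lambda>i. x i \<odot>\<^bsub>B\<^esub> e i) \<in> S \<rightarrow> carrier B"
    using assms(4) by (auto simp: value_closed idem_closed)
  have "g (finsum B (\<lambda>i. x i \<odot>\<^bsub>B\<^esub> e i) S) = finsum U (\<lambda>i. g (x i \<odot>\<^bsub>B\<^esub> e i)) S"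
    by (rule linear_maps_finsum[OF split_module assms(1,2) c])
  also have "\<dots> = finsum U (\<lambda>i. h (x i \<odot>\<^bsub>B\<^esub> e i)) S"
    using assms by (intro U.M.finsum_cong')
      (auto simp: linear_maps_smult[OF assms(2)] linear_maps_simps[OF assms(3)] value_closed idem_closed)
  also have "\<dots> = h (finsum B (\<lambda>i. x i \<odot>\<^bsub>B\<^esub> e i) S)"
    by (rule linear_maps_finsum[OF split_module assms(1,3) c, symmetric])
  finally show ?thesis by (simp add: idem_expansion assms(4))
qed


section \<open>Tensor products with the split algebra\<close>

text \<open>
  Since \<open>B = K\<^sup>n\<close>, the tensor product \<open>B \<otimes> W\<close> is \<open>W\<^sup>n\<close>; the slices are the n components of this
  isomorphism. Taking \<open>W = B\<close> and \<open>W = B \<otimes> B\<close> turns tensors in two and three factors into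
  arrays of scalars.
\<close>

definition slice where
  "slice W i = tensor_lift K W (\<lambda>x w. x i \<odot>\<^bsub>W\<^esub> w)"

lemma slice:
  assumes "module K W" "i \<in> S"
  shows slice_linear: "slice W i \<in> linear_maps K (tensor_module K B W) W"
    and slice_pure: "x \<in> carrier B \<Longrightarrow> w \<in> carrier W \<Longrightarrow> slice W i (pure_tensor K B W x w) = x i \<odot>\<^bsub>W\<^esub> w"
proof -
  interpret T: tensor_of_modules K B W
    using assms split_module by (simp add: tensor_of_modules_def)
  note b = bilinear_maps_comp[OF smult_bilinear[OF assms(1)] value_linear[OF assms(2)] linear_maps_id]
  show "slice W i \<in> linear_maps K T.T W"
    and "x \<in> carrier B \<Longrightarrow> w \<in> carrier W \<Longrightarrow> slice W i (pure_tensor K B W x w) = x i \<odot>\<^bsub>W\<^esub> w"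
    unfolding slice_def
    using T.tensor_lift_linear[OF assms(1) b] T.tensor_lift_pure[OF assms(1) b] by auto
qed

text \<open>
  Both sides are linear in X, so it is enough to take \<open>X = x \<otimes> w\<close>. There the i-th term is
  \<open>e\<^sub>i \<otimes> x\<^sub>i w = x\<^sub>i e\<^sub>i \<otimes> w\<close>, and the terms add up to \<open>x \<otimes> w\<close> by the expansion of x in idempotents.
\<close>

lemma slice_expansion:
  assumes W: "module K W" and X: "X \<in> carrier (tensor_module K B W)"
  shows "finsum (tensor_module K B W) (\<lambda>i. pure_tensor K B W (e i) (slice W i X)) S = X"
proof -
  interpret T: tensor_of_modules K B W
    using assms split_module by (simp add: tensor_of_modules_def)
  note s = linear_maps_simps[OF slice_linear[OF W]]
  note p = linear_maps_simps[OF bilinear_maps_right[OF T.pure_bilinear idem_closed]]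
  let ?g = "\<lambda>X. finsum T.T (\<lambda>i. pure_tensor K B W (e i) (slice W i X)) S"
  have "?g \<in> linear_maps K T.T T.T"
  proof (rule linear_mapsI)
    fix X Y assume X: "X \<in> carrier T.T" and Y: "Y \<in> carrier T.T"
    have "?g (X \<oplus>\<^bsub>T.T\<^esub> Y) =
        finsum T.T (\<lambda>i. pure_tensor K B W (e i) (slice W i X) \<oplus>\<^bsub>T.T\<^esub> pure_tensor K B W (e i) (slice W i Y)) S"
      using X Y by (intro T.T.M.finsum_cong') (simp_all add: s p)
    also have "\<dots> = ?g X \<oplus>\<^bsub>T.T\<^esub> ?g Y"
      using X Y by (intro T.T.M.finsum_addf) (simp_all add: s p)
    finally show "?g (X \<oplus>\<^bsub>T.T\<^esub> Y) = ?g X \<oplus>\<^bsub>T.T\<^esub> ?g Y" .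
  next
    fix c X assume c: "c \<in> carrier K" and X: "X \<in> carrier T.T"
    have "?g (c \<odot>\<^bsub>T.T\<^esub> X) = finsum T.T (\<lambda>i. c \<odot>\<^bsub>T.T\<^esub> pure_tensor K B W (e i) (slice W i X)) S"
      using c X by (intro T.T.M.finsum_cong') (simp_all add: s p)
    also have "\<dots> = c \<odot>\<^bsub>T.T\<^esub> ?g X"
      using c X by (intro T.T.finsum_smult_ldistr[symmetric]) (simp_all add: s p)
    finally show "?g (c \<odot>\<^bsub>T.T\<^esub> X) = c \<odot>\<^bsub>T.T\<^esub> ?g X" .
  qed (auto simp: s p)
  moreover have "?g (pure_tensor K B W x w) = pure_tensor K B W x w"
    if x: "x \<in> carrier B" and w: "w \<in> carrier W" for x w
  proof -
    note l = bilinear_maps_left[OF T.pure_bilinear w]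
    have "?g (pure_tensor K B W x w) = finsum T.T (\<lambda>i. pure_tensor K B W (x i \<odot>\<^bsub>B\<^esub> e i) w) S"
      using x w by (intro T.T.M.finsum_cong')
        (auto simp: slice_pure[OF W] p linear_maps_smult[OF l] value_closed idem_closed T.pure_closed)
    also have "\<dots> = pure_tensor K B W (finsum B (\<lambda>i. x i \<odot>\<^bsub>B\<^esub> e i) S) w"
      using x by (intro linear_maps_finsum[OF split_module T.tensor_module_module l, symmetric])
        (auto simp: value_closed idem_closed)
    finally show ?thesis by (simp add: idem_expansion x)
  qed
  ultimately show ?thesis
    by (rule T.linear_maps_eq_on_tensor[where g = ?g and h = "\<lambda>X. X", OF _ linear_maps_id X])
qed

text \<open>
  This replaces the question of when two formal sums lie in the same coset: equality in \<open>B \<otimes> W\<close>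
  is reduced to equality in W.
\<close>

lemma slice_eqI:
  assumes "module K W" "X \<in> carrier (tensor_module K B W)" "Y \<in> carrier (tensor_module K B W)"
    and "\<And>i. i \<in> S \<Longrightarrow> slice W i X = slice W i Y"
  shows "X = Y"
proof -
  interpret T: tensor_of_modules K B W
    using assms split_module by (simp add: tensor_of_modules_def)
  have "finsum T.T (\<lambda>i. pure_tensor K B W (e i) (slice W i X)) S =
      finsum T.T (\<lambda>i. pure_tensor K B W (e i) (slice W i Y)) S"
    using assms by (intro T.T.M.finsum_cong')
      (auto intro!: T.pure_closed idem_closed linear_maps_closed[OF slice_linear])
  then show ?thesis
    using assms by (simp add: slice_expansion)
qed

sublocale BB: tensor_of_modules K B B
  using split_module by (simp add: tensor_of_modules_def)

lemmas BB_module = BB.tensor_module_module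

sublocale BB_B: tensor_of_modules K BB B
  using split_module BB_module by (simp add: tensor_of_modules_def)

abbreviation "B_BB \<equiv> tensor_module K B BB"

definition coef where "coef X i j = slice B i X j"

definition coef3 where "coef3 Z i j k = coef (slice BB i Z) j k"

lemma coef_linear: "i \<in> S \<Longrightarrow> j \<in> S \<Longrightarrow> (\<lambda>X. coef X i j) \<in> linear_maps K BB R"
  unfolding coef_def by (rule linear_maps_comp[OF value_linear slice_linear[OF split_module]])

lemma coef_closed: "X \<in> carrier BB \<Longrightarrow> i \<in> S \<Longrightarrow> j \<in> S \<Longrightarrow> coef X i j \<in> carrier K"
  using linear_maps_closed[OF coef_linear] by auto

lemma coef_pure:
  "x \<in> carrier B \<Longrightarrow> y \<in> carrier B \<Longrightarrow> i \<in> S \<Longrightarrow> j \<in> S \<Longrightarrow> coef (pure_tensor K B B x y) i j = x i \<otimes> y j"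
  unfolding coef_def by (simp add: slice_pure[OF split_module] op_value)

lemma coef_eqI:
  assumes "X \<in> carrier BB" "Y \<in> carrier BB" "\<And>i j. i \<in> S \<Longrightarrow> j \<in> S \<Longrightarrow> coef X i j = coef Y i j"
  shows "X = Y"
  using assms unfolding coef_def
  by (intro slice_eqI[OF split_module] split_eqI) (auto intro!: linear_maps_closed[OF slice_linear[OF split_module]])

lemma coef3_linear: "i \<in> S \<Longrightarrow> j \<in> S \<Longrightarrow> k \<in> S \<Longrightarrow> (\<lambda>X. coef3 X i j k) \<in> linear_maps K B_BB R"
  unfolding coef3_def by (rule linear_maps_comp[OF coef_linear slice_linear[OF BB_module]])

lemma coef3_pure:
  "\<lbrakk>x \<in> carrier B; Y \<in> carrier BB; i \<in> S; j \<in> S; k \<in> S\<rbrakk> \<Longrightarrow>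
    coef3 (pure_tensor K B BB x Y) i j k = x i \<otimes> coef Y j k"
  unfolding coef3_def by (simp add: slice_pure[OF BB_module] linear_maps_smult[OF coef_linear] value_closed)

lemma coef3_eqI:
  assumes "X \<in> carrier B_BB" "Y \<in> carrier B_BB"
    and "\<And>i j k. i \<in> S \<Longrightarrow> j \<in> S \<Longrightarrow> k \<in> S \<Longrightarrow> coef3 X i j k = coef3 Y i j k"
  shows "X = Y"
  using assms unfolding coef3_def
  by (intro slice_eqI[OF BB_module] coef_eqI) (auto intro!: linear_maps_closed[OF slice_linear[OF BB_module]])

text \<open>
  Stated for an arbitrary tensor X in the first two factors, because it is applied to
  \<open>\<Delta> x \<otimes> z\<close>, where \<open>\<Delta> x\<close> is not a pure tensor.
\<close>

lemma coef3_assoc: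
  assumes "X \<in> carrier BB" "z \<in> carrier B" and ijk: "i \<in> S" "j \<in> S" "k \<in> S"
  shows "coef3 (tensor_assoc K B B B (pure_tensor K BB B X z)) i j k = coef X i j \<otimes> z k"
proof -
  note t = tensor_assoc[OF split_module split_module split_module]
  note p = bilinear_maps_left[OF BB_B.pure_bilinear assms(2)]
  note l = linear_maps_comp[OF coef3_linear[OF ijk] linear_maps_comp[OF t(1) p]]
  note c = coef_linear[OF ijk(1,2)]
  show ?thesis using assms(1)
  proof (induction rule: BB.tensor_induct)
    case (pure x y)
    then show ?case
      using assms by (simp add: t(2) coef3_pure coef_pure BB.pure_closed value_closed m_assoc)
  next
    case (add X Y)
    then show ?case
      using linear_maps_add[OF l, of X Y] linear_maps_add[OF c, of X Y] assms
      by (simp add: coef_closed value_closed l_distr)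
  next
    case (smult a X)
    then show ?case
      using linear_maps_smult[OF l, of a X] linear_maps_smult[OF c, of a X] assms
      by (simp add: coef_closed value_closed m_assoc)
  qed
qed

lemma coef_finsum:
  assumes "A \<subseteq> S \<times> S" "\<And>k l. (k, l) \<in> A \<Longrightarrow> a k l \<in> carrier K" and ij: "i \<in> S" "j \<in> S"
  shows "coef (finsum BB (\<lambda>(k, l). a k l \<odot>\<^bsub>BB\<^esub> pure_tensor K B B (e k) (e l)) A) i j =
    (if (i, j) \<in> A then a i j else \<zero>)"
proof -
  have fin: "finite A" using assms(1) by (rule finite_subset) simp
  have c: "(\<lambda>(k, l). a k l \<odot>\<^bsub>BB\<^esub> pure_tensor K B B (e k) (e l)) \<in> A \<rightarrow> carrier BB"
    using assms(2) by (auto simp: BB.pure_closed idem_closed)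
  have "coef (finsum BB (\<lambda>(k, l). a k l \<odot>\<^bsub>BB\<^esub> pure_tensor K B B (e k) (e l)) A) i j =
      finsum K (\<lambda>p. coef (case p of (k, l) \<Rightarrow> a k l \<odot>\<^bsub>BB\<^esub> pure_tensor K B B (e k) (e l)) i j) A"
    using linear_maps_finsum[OF BB_module regular_module[OF is_cring] coef_linear[OF ij] c] c ij
    by (simp add: finsum_regular_algebra is_cring coef_closed Pi_iff)
  also have "\<dots> = finsum K (\<lambda>p. if (i, j) = p then a (fst p) (snd p) else \<zero>) A"
    using assms by (intro finsum_cong')
      (auto simp: linear_maps_smult[OF coef_linear] coef_pure BB.pure_closed idem_closed idem_value split: if_splits)
  also have "\<dots> = (if (i, j) \<in> A then a i j else \<zero>)"
  proof (cases "(i, j) \<in> A")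
    case True
    then have "finsum K (\<lambda>p. if (i, j) = p then a (fst p) (snd p) else \<zero>) A = a (fst (i, j)) (snd (i, j))"
      using fin assms(2) by (intro finsum_singleton) auto
    with True show ?thesis by simp
  next
    case False
    then have "finsum K (\<lambda>p. if (i, j) = p then a (fst p) (snd p) else \<zero>) A = finsum K (\<lambda>p. \<zero>) A"
      by (intro finsum_cong') auto
    with False show ?thesis by simp
  qed
  finally show ?thesis .
qed

text \<open>
  Multiplication in \<open>B \<otimes> B\<close> is entrywise: the claim is linear in X and in Y, and on pure tensors
  it is commutativity of K. Hence each entry is a character of \<open>B \<otimes> B\<close>.
\<close>

lemma coef_mult:
  assumes X: "X \<in> carrier BB" and Y: "Y \<in> carrier BB" and ij: "i \<in> S" "j \<in> S"
  shows "coef (X \<otimes>\<^bsub>tensor_algebra K B B\<^esub> Y) i j = coef X i j \<otimes> coef Y i j"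
proof -
  note m = tensor_algebra_mult[OF split_assoc_algebra split_assoc_algebra]
  note c = coef_linear[OF ij]
  let ?M = "mult (tensor_algebra K B B)"
  have pp: "coef (?M (pure_tensor K B B x y) Y) i j = (x i \<otimes> y j) \<otimes> coef Y i j"
    if x: "x \<in> carrier B" and y: "y \<in> carrier B" for x y
  proof -
    note l = linear_maps_comp[OF c bilinear_maps_right[OF m(1) BB.pure_closed[OF x y]]]
    show ?thesis using Y
    proof (induction rule: BB.tensor_induct)
      case (pure x' y')
      then show ?case
        using x y ij by (simp add: m(2) coef_pure value_closed op_value m_ac op_closed)
    next
      case (add X' Y')
      then show ?case
        using linear_maps_add[OF l, of X' Y'] linear_maps_add[OF c, of X' Y'] x y ij
        by (simp add: coef_closed value_closed r_distr)
    next
      case (smult a X')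
      then show ?case
        using linear_maps_smult[OF l, of a X'] linear_maps_smult[OF c, of a X'] x y ij
        by (simp add: coef_closed value_closed m_ac)
    qed
  qed
  note l = linear_maps_comp[OF c bilinear_maps_left[OF m(1) Y]]
  show ?thesis using X
  proof (induction rule: BB.tensor_induct)
    case (pure x y)
    then show ?case using ij by (simp add: pp coef_pure)
  next
    case (add X' Y')
    then show ?case
      using linear_maps_add[OF l, of X' Y'] linear_maps_add[OF c, of X' Y'] Y ij
      by (simp add: coef_closed l_distr)
  next
    case (smult a X')
    then show ?case
      using linear_maps_smult[OF l, of a X'] linear_maps_smult[OF c, of a X'] Y ij
      by (simp add: coef_closed m_assoc)
  qed
qed

lemma coef_algebra_hom:
  assumes ij: "i \<in> S" "j \<in> S"
  shows "(\<lambda>X. coef X i j) \<in> algebra_homs K (tensor_algebra K B B) R"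
  using coef_linear[OF ij] linear_maps_add[OF coef_linear[OF ij]] ij op_closed(2)
  by (auto simp: algebra_homs_def ring_hom_def coef_mult coef_closed coef_pure linear_maps_def
      op_value)


section \<open>Linear maps dual to a binary operation\<close>

text \<open>
  Read B as the algebra of functions on S and \<open>B \<otimes> B\<close> as that of functions on \<open>S \<times> S\<close>. The
  condition then says that \<open>\<Delta>\<close> and \<open>\<epsilon>\<close> are the pullbacks of functions along
  \<open>f : S \<times> S \<rightarrow> S\<close> and along the inclusion of the point u.
\<close>

definition dualizes where
  "dualizes f u \<Delta> \<epsilon> \<longleftrightarrow>
    \<Delta> \<in> linear_maps K B BB \<and> \<epsilon> \<in> linear_maps K B R \<and>
    (\<forall>x\<in>carrier B. \<forall>i\<in>S. \<forall>j\<in>S. coef (\<Delta> x) i j = x (f i j)) \<and>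
    (\<forall>x\<in>carrier B. \<epsilon> x = x u)"

text \<open>
  The two descriptions differ only in the test vectors: the prescribed value of \<open>\<Delta> e\<^sub>m\<close> is the
  tensor whose \<open>(i, j)\<close> entry is \<open>e\<^sub>m (f i j)\<close>, and linearity extends this from the idempotents
  to all x.
\<close>

lemma comult_counit_of_iff_dualizes:
  assumes f: "\<And>i j. i \<in> S \<Longrightarrow> j \<in> S \<Longrightarrow> f i j \<in> S" and u: "u \<in> S"
  shows "comult_counit_of K n f u \<Delta> \<epsilon> \<longleftrightarrow> dualizes f u \<Delta> \<epsilon>"
proof -
  let ?A = "\<lambda>m. {(k, l) \<in> S \<times> S. f k l = m}"
  let ?D = "\<lambda>m. finsum BB (\<lambda>(k, l). pure_tensor K B B (e k) (e l)) (?A m)"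
  have D_closed: "?D m \<in> carrier BB" for m
    by (intro BB.T.M.finsum_closed) (auto intro: BB.pure_closed idem_closed)
  have D: "coef (?D m) i j = e m (f i j)" if "i \<in> S" "j \<in> S" for m i j
  proof -
    have "?D m = finsum BB (\<lambda>(k, l). \<one> \<odot>\<^bsub>BB\<^esub> pure_tensor K B B (e k) (e l)) (?A m)"
      by (intro BB.T.M.finsum_cong') (auto intro: BB.pure_closed idem_closed simp: BB.pure_closed idem_closed)
    moreover have "coef (finsum BB (\<lambda>(k, l). \<one> \<odot>\<^bsub>BB\<^esub> pure_tensor K B B (e k) (e l)) (?A m)) i j =
        (if (i, j) \<in> ?A m then \<one> else \<zero>)"
      using that by (intro coef_finsum) auto
    ultimately have "coef (?D m) i j = (if (i, j) \<in> ?A m then \<one> else \<zero>)"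
      by (simp only:)
    then show ?thesis using that f idem_value by simp
  qed
  have "(\<forall>m\<in>S. \<Delta> (e m) = ?D m) \<longleftrightarrow> (\<forall>x\<in>carrier B. \<forall>i\<in>S. \<forall>j\<in>S. coef (\<Delta> x) i j = x (f i j))"
    if \<Delta>: "\<Delta> \<in> linear_maps K B BB"
  proof
    assume *: "\<forall>m\<in>S. \<Delta> (e m) = ?D m"
    show "\<forall>x\<in>carrier B. \<forall>i\<in>S. \<forall>j\<in>S. coef (\<Delta> x) i j = x (f i j)"
    proof (intro ballI)
      fix x i j assume x: "x \<in> carrier B" and ij: "i \<in> S" "j \<in> S"
      show "coef (\<Delta> x) i j = x (f i j)"
        by (rule linear_maps_eq_on_idems[OF regular_module[OF is_cring]
              linear_maps_comp[OF coef_linear[OF ij] \<Delta>] value_linear[OF f[OF ij]] x])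
          (use * D ij in auto)
    qed
  next
    assume *: "\<forall>x\<in>carrier B. \<forall>i\<in>S. \<forall>j\<in>S. coef (\<Delta> x) i j = x (f i j)"
    show "\<forall>m\<in>S. \<Delta> (e m) = ?D m"
      using * D by (intro ballI coef_eqI D_closed linear_maps_closed[OF \<Delta>] idem_closed) (simp add: idem_closed)
  qed
  moreover have "(\<forall>i\<in>S. \<epsilon> (e i) = (if i = u then \<one> else \<zero>)) \<longleftrightarrow> (\<forall>x\<in>carrier B. \<epsilon> x = x u)"
    if \<epsilon>: "\<epsilon> \<in> linear_maps K B R"
  proof
    assume *: "\<forall>i\<in>S. \<epsilon> (e i) = (if i = u then \<one> else \<zero>)"
    show "\<forall>x\<in>carrier B. \<epsilon> x = x u"
      using linear_maps_eq_on_idems[OF regular_module[OF is_cring] \<epsilon> value_linear[OF u]] * idem_value[OF u] by auto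
  qed (use idem_value[OF u] idem_closed in auto)
  ultimately show ?thesis
    unfolding comult_counit_of_def dualizes_def Let_def finsum_tensor_algebra linear_maps_tensor_algebra
    by blast
qed

lemma ex_dualizes:
  assumes f: "\<And>i j. i \<in> S \<Longrightarrow> j \<in> S \<Longrightarrow> f i j \<in> S" and u: "u \<in> S"
  shows "\<exists>\<Delta> \<epsilon>. dualizes f u \<Delta> \<epsilon>"
proof (intro exI)
  let ?\<Delta> = "\<lambda>x. finsum BB (\<lambda>(k, l). x (f k l) \<odot>\<^bsub>BB\<^esub> pure_tensor K B B (e k) (e l)) (S \<times> S)"
  have cl: "?\<Delta> x \<in> carrier BB" if "x \<in> carrier B" for x
    using that f by (intro BB.T.M.finsum_closed) (auto intro!: BB.pure_closed idem_closed value_closed)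
  have cf: "coef (?\<Delta> x) i j = x (f i j)" if "x \<in> carrier B" "i \<in> S" "j \<in> S" for x i j
    using coef_finsum[of "S \<times> S" "\<lambda>k l. x (f k l)" i j] that f value_closed[OF that(1)] by auto
  have "?\<Delta> \<in> linear_maps K B BB"
  proof (rule linear_mapsI)
    fix x y assume "x \<in> carrier B" "y \<in> carrier B"
    then show "?\<Delta> (x \<oplus>\<^bsub>B\<^esub> y) = ?\<Delta> x \<oplus>\<^bsub>BB\<^esub> ?\<Delta> y"
      using f by (intro coef_eqI) (simp_all only: cl cf B.M.a_closed BB.T.M.a_closed op_value linear_maps_add[OF coef_linear] regular_algebra_simps)
  next
    fix c x assume "c \<in> carrier K" "x \<in> carrier B"
    then show "?\<Delta> (c \<odot>\<^bsub>B\<^esub> x) = c \<odot>\<^bsub>BB\<^esub> ?\<Delta> x"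
      using f by (intro coef_eqI) (simp_all only: cl cf B.smult_closed BB.T.smult_closed op_value linear_maps_smult[OF coef_linear] regular_algebra_simps)
  qed (rule cl)
  then show "dualizes f u ?\<Delta> (\<lambda>x. x u)"
    unfolding dualizes_def using cf value_linear[OF u] by auto
qed

end


section \<open>The bialgebra axioms as monoid axioms\<close>

locale split_algebra_duality = split_algebra_over +
  fixes f :: "nat \<Rightarrow> nat \<Rightarrow> nat" and u :: nat and \<Delta> \<epsilon>
  assumes op_in: "i \<in> S \<Longrightarrow> j \<in> S \<Longrightarrow> f i j \<in> S" and unit_in: "u \<in> S"
    and dual: "dualizes f u \<Delta> \<epsilon>"
begin

lemma comult_lin: "\<Delta> \<in> linear_maps K B BB" and counit_lin: "\<epsilon> \<in> linear_maps K B R"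
  and coef_comult: "x \<in> carrier B \<Longrightarrow> i \<in> S \<Longrightarrow> j \<in> S \<Longrightarrow> coef (\<Delta> x) i j = x (f i j)"
  and counit_value: "x \<in> carrier B \<Longrightarrow> \<epsilon> x = x u"
  using dual by (auto simp: dualizes_def)

text \<open>
  Pullback along any map of sets preserves pointwise products and the constant function 1.
\<close>

lemma comult_algebra_hom: "\<Delta> \<in> algebra_homs K B (tensor_algebra K B B)"
proof -
  note m = bilinear_maps_left[OF tensor_algebra_mult_bilinear[OF split_assoc_algebra split_assoc_algebra]]
  note cl = linear_maps_closed[OF comult_lin]
  have "\<Delta> (x \<otimes>\<^bsub>B\<^esub> y) = \<Delta> x \<otimes>\<^bsub>tensor_algebra K B B\<^esub> \<Delta> y" if "x \<in> carrier B" "y \<in> carrier B" for x y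
    using that op_in
    by (intro coef_eqI linear_maps_closed[OF m]) (simp_all only: coef_mult coef_comult cl op_closed op_value)
  moreover have "\<Delta> \<one>\<^bsub>B\<^esub> = pure_tensor K B B \<one>\<^bsub>B\<^esub> \<one>\<^bsub>B\<^esub>"
    using op_in
    by (intro coef_eqI BB.pure_closed cl op_closed(2))
      (simp_all only: coef_comult coef_pure op_closed op_value l_one one_closed)
  ultimately show ?thesis
    using comult_lin by (auto simp: algebra_homs_def ring_hom_def linear_maps_simps linear_maps_tensor_algebra)
qed

lemma counit_algebra_hom: "\<epsilon> \<in> algebra_homs K B R"
  using counit_lin unit_in
  by (auto simp: algebra_homs_def ring_hom_def linear_maps_def op_closed counit_value op_value)

text \<open>
  The two sides of coassociativity are computed for an arbitrary t in place of \<open>\<Delta> x\<close>, where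
  linearity reduces the claim to pure tensors. For \<open>t = \<Delta> x\<close> the results are
  \<open>x (f (f i j) k)\<close> and \<open>x (f i (f j k))\<close>.
\<close>

lemma coef3_comult_left:
  assumes t: "t \<in> carrier BB" and ijk: "i \<in> S" "j \<in> S" "k \<in> S"
  shows "coef3 (tensor_assoc K B B B (tensor_map K BB B \<Delta> (\<lambda>y. y) t)) i j k = coef t (f i j) k"
proof -
  note a = tensor_assoc_linear[OF split_module split_module split_module]
  note m = tensor_map[OF split_module split_module BB_module split_module comult_lin linear_maps_id]
  show ?thesis
    by (rule BB.linear_maps_eq_on_tensor[OF linear_maps_comp[OF coef3_linear[OF ijk] linear_maps_comp[OF a m(1)]]
          coef_linear[OF op_in[OF ijk(1,2)] ijk(3)] t])
      (use ijk op_in in \<open>simp only: m(2) coef3_assoc coef_comult linear_maps_closed[OF comult_lin] coef_pure\<close>)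
qed

lemma coef3_comult_right:
  assumes t: "t \<in> carrier BB" and ijk: "i \<in> S" "j \<in> S" "k \<in> S"
  shows "coef3 (tensor_map K B BB (\<lambda>y. y) \<Delta> t) i j k = coef t i (f j k)"
proof -
  note m = tensor_map[OF split_module split_module split_module BB_module linear_maps_id comult_lin]
  show ?thesis
    by (rule BB.linear_maps_eq_on_tensor[OF linear_maps_comp[OF coef3_linear[OF ijk] m(1)]
          coef_linear[OF ijk(1) op_in[OF ijk(2,3)]] t])
      (use ijk op_in in \<open>simp only: m(2) coef3_pure coef_comult linear_maps_closed[OF comult_lin] coef_pure\<close>)
qed

lemma coassoc_iff:
  assumes x: "x \<in> carrier B"
  shows "tensor_assoc K B B B (tensor_map K BB B \<Delta> (\<lambda>y. y) (\<Delta> x)) = tensor_map K B BB (\<lambda>y. y) \<Delta> (\<Delta> x) \<longleftrightarrow>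
    (\<forall>i\<in>S. \<forall>j\<in>S. \<forall>k\<in>S. x (f (f i j) k) = x (f i (f j k)))" (is "?l = ?r \<longleftrightarrow> ?a")
proof -
  note a = tensor_assoc_linear[OF split_module split_module split_module]
  note ml = tensor_map_linear[OF split_module split_module BB_module split_module comult_lin linear_maps_id]
  note mr = tensor_map_linear[OF split_module split_module split_module BB_module linear_maps_id comult_lin]
  have \<Delta>: "\<Delta> x \<in> carrier BB" by (rule linear_maps_closed[OF comult_lin x])
  have v: "coef3 ?l i j k = x (f (f i j) k)" "coef3 ?r i j k = x (f i (f j k))"
    if "i \<in> S" "j \<in> S" "k \<in> S" for i j k
    using that op_in by (simp_all only: coef3_comult_left coef3_comult_right coef_comult \<Delta> x)
  show ?thesis
  proof
    assume "?l = ?r"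
    then show ?a using v by metis
  next
    assume ?a
    then show "?l = ?r"
      using v by (intro coef3_eqI linear_maps_closed[OF a] linear_maps_closed[OF ml] linear_maps_closed[OF mr] \<Delta>)
        (simp only: v)
  qed
qed

lemma counit_left_iff:
  assumes x: "x \<in> carrier B"
  shows "tensor_lift K B (\<lambda>c y. c \<odot>\<^bsub>B\<^esub> y) (tensor_map K R B \<epsilon> (\<lambda>y. y) (\<Delta> x)) = x \<longleftrightarrow>
    (\<forall>i\<in>S. x (f u i) = x i)" (is "?l = x \<longleftrightarrow> ?a")
proof -
  interpret RB: tensor_of_modules K R B
    using split_module regular_module[OF is_cring] by (simp add: tensor_of_modules_def)
  note b = smult_bilinear[OF split_module]
  note l = RB.tensor_lift_linear[OF split_module b]
  note m = tensor_map[OF split_module split_module regular_module[OF is_cring] split_module counit_lin linear_maps_id]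
  have \<Delta>: "\<Delta> x \<in> carrier BB" by (rule linear_maps_closed[OF comult_lin x])
  have v: "?l i = x (f u i)" if i: "i \<in> S" for i
  proof -
    have "?l i = coef (\<Delta> x) u i"
    proof (rule BB.linear_maps_eq_on_tensor[OF linear_maps_comp[OF value_linear[OF i] linear_maps_comp[OF l m(1)]]
          coef_linear[OF unit_in i] \<Delta>])
      fix y z assume y: "y \<in> carrier B" "z \<in> carrier B"
      then have "\<epsilon> y \<in> carrier R" by (rule_tac linear_maps_closed[OF counit_lin])
      with y i unit_in show "tensor_lift K B (\<lambda>c y. c \<odot>\<^bsub>B\<^esub> y) (tensor_map K R B \<epsilon> (\<lambda>y. y) (pure_tensor K B B y z)) i =
          coef (pure_tensor K B B y z) u i"
        by (simp only: m(2) RB.tensor_lift_pure[OF split_module b] coef_pure op_value counit_value)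
    qed
    then show ?thesis using i unit_in x by (simp only: coef_comult)
  qed
  have "?l \<in> carrier B" by (rule linear_maps_closed[OF l linear_maps_closed[OF m(1) \<Delta>]])
  then show ?thesis using v x by (metis split_eqI)
qed

lemma counit_right_iff:
  assumes x: "x \<in> carrier B"
  shows "tensor_lift K B (\<lambda>y c. c \<odot>\<^bsub>B\<^esub> y) (tensor_map K B R (\<lambda>y. y) \<epsilon> (\<Delta> x)) = x \<longleftrightarrow>
    (\<forall>i\<in>S. x (f i u) = x i)" (is "?l = x \<longleftrightarrow> ?a")
proof -
  interpret BR: tensor_of_modules K B R
    using split_module regular_module[OF is_cring] by (simp add: tensor_of_modules_def)
  note b = bilinear_maps_flip[OF smult_bilinear[OF split_module]]
  note l = BR.tensor_lift_linear[OF split_module b]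
  note m = tensor_map[OF split_module split_module split_module regular_module[OF is_cring] linear_maps_id counit_lin]
  have \<Delta>: "\<Delta> x \<in> carrier BB" by (rule linear_maps_closed[OF comult_lin x])
  have v: "?l i = x (f i u)" if i: "i \<in> S" for i
  proof -
    have "?l i = coef (\<Delta> x) i u"
    proof (rule BB.linear_maps_eq_on_tensor[OF linear_maps_comp[OF value_linear[OF i] linear_maps_comp[OF l m(1)]]
          coef_linear[OF i unit_in] \<Delta>])
      fix y z assume y: "y \<in> carrier B" "z \<in> carrier B"
      then have "\<epsilon> z \<in> carrier R" by (rule_tac linear_maps_closed[OF counit_lin])
      with y i unit_in show "tensor_lift K B (\<lambda>y c. c \<odot>\<^bsub>B\<^esub> y) (tensor_map K B R (\<lambda>y. y) \<epsilon> (pure_tensor K B B y z)) i =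
          coef (pure_tensor K B B y z) i u"
        by (simp only: m(2) BR.tensor_lift_pure[OF split_module b] coef_pure op_value counit_value m_comm value_closed)
    qed
    then show ?thesis using i unit_in x by (simp only: coef_comult)
  qed
  have "?l \<in> carrier B" by (rule linear_maps_closed[OF l linear_maps_closed[OF m(1) \<Delta>]])
  then show ?thesis using v x by (metis split_eqI)
qed

text \<open>
  Coassociativity and the counit laws say that every function on S takes equal values at
  \<open>(i j) k\<close> and \<open>i (j k)\<close>, at \<open>u i\<close> and i, and at \<open>i u\<close> and i. Functions separate the points of S,
  because \<open>0 \<noteq> 1\<close> in K, so these are the monoid laws.
\<close>

theorem bialgebra_iff_monoid:
  assumes "field K"
  shows "bialgebra K B \<Delta> \<epsilon> \<longleftrightarrow> Group.monoid \<lparr>carrier = S, monoid.mult = f, one = u\<rparr>"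
proof
  assume "bialgebra K B \<Delta> \<epsilon>"
  then interpret bialgebra K B \<Delta> \<epsilon> .
  interpret K: field K by fact
  \<comment> \<open>An idempotent distinguishes its own point from every other one.\<close>
  have sep: "i = j" if "i \<in> S" "j \<in> S" "e i i = e i j" for i j
    using that by (auto simp: idem_value split: if_splits)
  have "f (f i j) k = f i (f j k)" if "i \<in> S" "j \<in> S" "k \<in> S" for i j k
    using coassoc_iff[OF idem_closed[of "f (f i j) k"]] coassoc[OF idem_closed[of "f (f i j) k"]] that op_in
    by (intro sep) blast+
  moreover have "f u i = i" if "i \<in> S" for i
    using counit_left_iff[OF idem_closed[of i]] counit_left[OF idem_closed[of i]] that op_in unit_in
    by (intro sep[symmetric]) (auto)
  moreover have "f i u = i" if "i \<in> S" for i
    using counit_right_iff[OF idem_closed[of i]] counit_right[OF idem_closed[of i]] that op_in unit_in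
    by (intro sep[symmetric]) (auto)
  ultimately show "Group.monoid \<lparr>carrier = S, monoid.mult = f, one = u\<rparr>"
    using op_in unit_in by (intro monoidI) (simp_all only: monoid.simps partial_object.simps)
next
  assume "Group.monoid \<lparr>carrier = S, monoid.mult = f, one = u\<rparr>"
  then interpret M: Group.monoid "\<lparr>carrier = S, monoid.mult = f, one = u\<rparr>" .
  have "coalgebra K B \<Delta> \<epsilon>"
  proof (intro coalgebra.intro coalgebra_axioms.intro)
    fix x assume x: "x \<in> carrier B"
    show "tensor_assoc K B B B (tensor_map K BB B \<Delta> (\<lambda>y. y) (\<Delta> x)) = tensor_map K B BB (\<lambda>y. y) \<Delta> (\<Delta> x)"
      using M.m_assoc by (simp add: coassoc_iff[OF x])
    show "tensor_lift K B (\<lambda>c y. c \<odot>\<^bsub>B\<^esub> y) (tensor_map K R B \<epsilon> (\<lambda>y. y) (\<Delta> x)) = x"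
      using M.l_one by (simp add: counit_left_iff[OF x])
    show "tensor_lift K B (\<lambda>y c. c \<odot>\<^bsub>B\<^esub> y) (tensor_map K B R (\<lambda>y. y) \<epsilon> (\<Delta> x)) = x"
      using M.r_one by (simp add: counit_right_iff[OF x])
  qed (rule assms split_module comult_lin counit_lin)+
  then show "bialgebra K B \<Delta> \<epsilon>"
    by (intro bialgebra.intro bialgebra_axioms.intro split_assoc_algebra comult_algebra_hom counit_algebra_hom)
qed

end


section \<open>Characters of the split algebra\<close>

context split_algebra_over
begin

text \<open>
  The values of a character at the \<open>e\<^sub>i\<close> are idempotents of a domain, hence 0 or 1, with pairwise
  product 0 and sum 1. So exactly one of them is 1, and the character is evaluation at that point.
\<close>

lemma algebra_hom_is_value:
  assumes "domain K" and \<phi>: "\<phi> \<in> algebra_homs K B R"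
  shows "\<exists>i\<in>S. \<forall>x\<in>carrier B. \<phi> x = x i"
proof -
  interpret domain K by fact
  have lin: "\<phi> \<in> linear_maps K B R" using \<phi> by (simp add: algebra_homs_def)
  have mult: "\<phi> (e i \<otimes>\<^bsub>B\<^esub> e j) = \<phi> (e i) \<otimes> \<phi> (e j)" for i j
    using \<phi> idem_closed by (auto simp: algebra_homs_def ring_hom_def)
  have cl: "\<phi> (e i) \<in> carrier K" for i using linear_maps_closed[OF lin idem_closed] by simp
  have "\<exists>k\<in>S. \<phi> (e k) \<noteq> \<zero>"
  proof (rule ccontr)
    assume "\<not> ?thesis"
    then have "\<phi> \<one>\<^bsub>B\<^esub> = \<zero>\<^bsub>R\<^esub>"
      by (intro linear_maps_eq_on_idems[OF regular_module[OF is_cring] lin _ op_closed(2), where h = "\<lambda>_. \<zero>\<^bsub>R\<^esub>"])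
        (auto intro!: linear_mapsI)
    moreover have "\<phi> \<one>\<^bsub>B\<^esub> = \<one>" using \<phi> by (auto simp: algebra_homs_def ring_hom_def)
    ultimately show False by simp
  qed
  then obtain k where k: "k \<in> S" "\<phi> (e k) \<noteq> \<zero>" by blast
  have "e k \<otimes>\<^bsub>B\<^esub> e k = e k"
    by (intro split_eqI op_closed idem_closed) (simp add: op_value idem_value)
  then have "\<phi> (e k) \<otimes> \<phi> (e k) = \<phi> (e k) \<otimes> \<one>" using mult[of k k] cl by simp
  then have one: "\<phi> (e k) = \<one>" using k cl m_lcancel by blast
  have zero: "\<phi> (e i) = \<zero>" if "i \<noteq> k" for i
  proof -
    have "e i \<otimes>\<^bsub>B\<^esub> e k = \<zero>\<^bsub>B\<^esub>"
      using that by (intro split_eqI op_closed idem_closed) (auto simp add: op_value idem_value)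
    then show ?thesis
      using mult[of i k] linear_maps_zero[OF split_module regular_module[OF is_cring] lin] cl one by simp
  qed
  have "\<phi> x = x k" if "x \<in> carrier B" for x
    by (rule linear_maps_eq_on_idems[OF regular_module[OF is_cring] lin value_linear[OF k(1)] that])
      (use k one zero in \<open>auto simp: idem_value\<close>)
  with k show ?thesis by blast
qed

text \<open>
  For each \<open>(i, j)\<close> the map \<open>x \<mapsto> (\<Delta> x)\<^sub>i\<^sub>j\<close> is a composite of algebra maps, hence a character of B;
  the point at which it evaluates is \<open>f i j\<close>. In the same way \<open>\<epsilon>\<close> yields u.
\<close>

lemma bialgebra_dualizes:
  assumes "bialgebra K B \<Delta> \<epsilon>"
  obtains f u where "\<And>i j. i \<in> S \<Longrightarrow> j \<in> S \<Longrightarrow> f i j \<in> S" "u \<in> S" "dualizes f u \<Delta> \<epsilon>"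
proof -
  interpret bialgebra K B \<Delta> \<epsilon> by fact
  have d: "domain K" by unfold_locales
  have "\<exists>m\<in>S. \<forall>x\<in>carrier B. coef (\<Delta> x) i j = x m" if "i \<in> S" "j \<in> S" for i j
    by (rule algebra_hom_is_value[OF d algebra_homs_comp[OF coef_algebra_hom[OF that] comult_hom]])
  then obtain f where "\<And>i j. i \<in> S \<Longrightarrow> j \<in> S \<Longrightarrow> f i j \<in> S \<and> (\<forall>x\<in>carrier B. coef (\<Delta> x) i j = x (f i j))"
    by metis
  moreover obtain u where "u \<in> S" "\<forall>x\<in>carrier B. \<epsilon> x = x u"
    using algebra_hom_is_value[OF d counit_hom] by blast
  ultimately show ?thesis
    using that[of f u] comult_linear counit_linear by (simp add: dualizes_def)
qed

end


section \<open>The correspondence\<close>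

lemma (in split_algebra_duality) structure_constant_eq:
  assumes a: "\<And>i j. i \<in> S \<Longrightarrow> j \<in> S \<Longrightarrow> a i j \<in> carrier K"
    and \<Delta>: "\<Delta> (e k) = finsum BB (\<lambda>(i, j). a i j \<odot>\<^bsub>BB\<^esub> pure_tensor K B B (e i) (e j)) (S \<times> S)"
    and ij: "i \<in> S" "j \<in> S"
  shows "a i j = (if f i j = k then \<one> else \<zero>)"
proof -
  have "coef (\<Delta> (e k)) i j = a i j"
    unfolding \<Delta> using a ij by (subst coef_finsum) auto
  moreover have "coef (\<Delta> (e k)) i j = e k (f i j)"
    by (rule coef_comult[OF idem_closed ij])
  ultimately show ?thesis by (simp only: idem_value[OF op_in[OF ij]])
qed

lemma monoid_cong:
  assumes "\<And>i j. i \<in> A \<Longrightarrow> j \<in> A \<Longrightarrow> g i j = f i j"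
    and "Group.monoid \<lparr>carrier = A, monoid.mult = f, one = u\<rparr>"
  shows "Group.monoid \<lparr>carrier = A, monoid.mult = g, one = u\<rparr>"
  using assms unfolding Group.monoid_def by simp

theorem theorem3p6:
  fixes K :: "('k, 'm) ring_scheme" and n :: nat
  assumes "field K" and "n \<ge> 1"
  shows "(let S = {1..n}; B = split_algebra K n; e = idem K n; T = tensor_algebra K B B in
    (\<forall>\<Delta> \<epsilon> a. bialgebra K B \<Delta> \<epsilon> \<longrightarrow>
       (\<forall>i\<in>S. \<forall>j\<in>S. \<forall>k\<in>S. a i j k \<in> carrier K) \<longrightarrow>
       (\<forall>k\<in>S. \<Delta> (e k) =
          finsum T (\<lambda>(i, j). a i j k \<odot>\<^bsub>T\<^esub> pure_tensor K B B (e i) (e j)) (S \<times> S)) \<longrightarrow>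
       (\<forall>i\<in>S. \<forall>j\<in>S. \<exists>!k. k \<in> S \<and> a i j k = \<one>\<^bsub>K\<^esub>) \<and>
       (\<exists>u. Group.monoid \<lparr>carrier = S,
                    monoid.mult = (\<lambda>i j. THE k. k \<in> S \<and> a i j k = \<one>\<^bsub>K\<^esub>),
                    one = u\<rparr>)) \<and>
    (\<forall>f u. Group.monoid \<lparr>carrier = S, monoid.mult = f, one = u\<rparr> \<longrightarrow>
       (\<exists>\<Delta> \<epsilon>. comult_counit_of K n f u \<Delta> \<epsilon>) \<and>
       (\<forall>\<Delta> \<epsilon>. comult_counit_of K n f u \<Delta> \<epsilon> \<longrightarrow> bialgebra K B \<Delta> \<epsilon>)))"
proof -
  interpret field K by fact
  interpret split_algebra_over K n by unfold_locales
  have "(\<forall>i\<in>S. \<forall>j\<in>S. \<exists>!k. k \<in> S \<and> a i j k = \<one>\<^bsub>K\<^esub>) \<and>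
      (\<exists>u. Group.monoid \<lparr>carrier = S, monoid.mult = (\<lambda>i j. THE k. k \<in> S \<and> a i j k = \<one>\<^bsub>K\<^esub>), one = u\<rparr>)"
    if bi: "bialgebra K B \<Delta> \<epsilon>"
      and a: "\<forall>i\<in>S. \<forall>j\<in>S. \<forall>k\<in>S. a i j k \<in> carrier K"
      and \<Delta>: "\<forall>k\<in>S. \<Delta> (e k) = finsum BB (\<lambda>(i, j). a i j k \<odot>\<^bsub>BB\<^esub> pure_tensor K B B (e i) (e j)) (S \<times> S)"
    for \<Delta> \<epsilon> a
  proof -
    obtain f u where f: "\<And>i j. i \<in> S \<Longrightarrow> j \<in> S \<Longrightarrow> f i j \<in> S" and u: "u \<in> S" and d: "dualizes f u \<Delta> \<epsilon>"
      using bialgebra_dualizes[OF bi] by metis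
    interpret D: split_algebra_duality K n f u \<Delta> \<epsilon>
      by (intro split_algebra_duality.intro split_algebra_duality_axioms.intro split_algebra_over_axioms f u d)
    have a_eq: "a i j k = \<one>\<^bsub>K\<^esub> \<longleftrightarrow> k = f i j" if "i \<in> S" "j \<in> S" "k \<in> S" for i j k
      using D.structure_constant_eq[of "\<lambda>i j. a i j k" k, OF _ bspec[OF \<Delta> that(3)] that(1,2)] a that(3)
      by auto
    have "(THE k. k \<in> S \<and> a i j k = \<one>\<^bsub>K\<^esub>) = f i j" if ij: "i \<in> S" "j \<in> S" for i j
    proof (rule the_equality)
      show "f i j \<in> S \<and> a i j (f i j) = \<one>\<^bsub>K\<^esub>"
        using a_eq[OF ij f[OF ij]] f[OF ij] by (simp only: simp_thms)
    qed (use a_eq[OF ij] in blast)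
    then have "Group.monoid \<lparr>carrier = S, monoid.mult = (\<lambda>i j. THE k. k \<in> S \<and> a i j k = \<one>\<^bsub>K\<^esub>), one = u\<rparr>"
      by (rule monoid_cong[OF _ D.bialgebra_iff_monoid[OF assms(1), THEN iffD1, OF bi]])
    moreover have "\<exists>!k. k \<in> S \<and> a i j k = \<one>\<^bsub>K\<^esub>" if ij: "i \<in> S" "j \<in> S" for i j
      using a_eq[OF ij] f[OF ij] by blast
    ultimately show ?thesis by blast
  qed
  moreover have "(\<exists>\<Delta> \<epsilon>. comult_counit_of K n f u \<Delta> \<epsilon>) \<and>
      (\<forall>\<Delta> \<epsilon>. comult_counit_of K n f u \<Delta> \<epsilon> \<longrightarrow> bialgebra K B \<Delta> \<epsilon>)"
    if M: "Group.monoid \<lparr>carrier = S, monoid.mult = f, one = u\<rparr>" for f u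
  proof -
    have f: "i \<in> S \<Longrightarrow> j \<in> S \<Longrightarrow> f i j \<in> S" and u: "u \<in> S" for i j
      using Group.monoid.m_closed[OF M] Group.monoid.one_closed[OF M] by simp_all
    note iff = comult_counit_of_iff_dualizes[of f u, OF f u]
    have "bialgebra K B \<Delta> \<epsilon>" if "dualizes f u \<Delta> \<epsilon>" for \<Delta> \<epsilon>
    proof -
      interpret D: split_algebra_duality K n f u \<Delta> \<epsilon>
        by (intro split_algebra_duality.intro split_algebra_duality_axioms.intro split_algebra_over_axioms f u that)
      show ?thesis by (rule D.bialgebra_iff_monoid[OF assms(1), THEN iffD2, OF M])
    qed
    then show ?thesis
      using ex_dualizes[of f u, OF f u] by (simp only: iff) blast
  qed
  ultimately show ?thesis
    unfolding Let_def finsum_tensor_algebra tensor_algebra_simps by blast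
qed

end
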